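(* For every integer $n\geq 3$, the poset $(P\!E_{n},\leq_{\mathrm{pchn}})$ is lexicographically shellable, that is, it admits an EL-labeling.
   Context: Write $[n]=\{1,\dots,n\}$. A set partition $\mathbf{x}$ of $[n]$ is noncrossing if for all $1\leq i<j<k<l\leq n$, whenever $i,k$ lie in a common block and $j,l$ lie in a common block, then $i,j$ lie in a common block; write $i\sim_{\mathbf{x}}j$ if $i,j$ lie in the same block. $NC_{n}$ is the set of noncrossing set partitions of $[n]$, and $\leq_{\mathrm{dref}}$ (dual refinement) is defined by $\mathbf{x}\leq_{\mathrm{dref}}\mathbf{y}$ iff every block of $\mathbf{x}$ is contained in a block of $\mathbf{y}$; $\mathbf{0}$ is the partition into singletons and $\mathbf{1}$ is the one-block partition. For $n\geq 3$, $P\!E_{n}$ is the set of all $\mathbf{x}\in NC_{n}$ such that $\{n-1,n\}$ is not a block of $\mathbf{x}$, and it is not the case that both $1\sim_{\mathbf{x}}n-1$ and $\{n\}$ is a block of $\mathbf{x}$. Parking labeling: if $\mathbf{y}$ covers $\mathbf{x}$ in $(NC_{n},\leq_{\mathrm{dref}})$, there are unique blocks $B_{1},B_{2}$ of $\mathbf{x}$ with $B_{1}\cup B_{2}$ a block of $\mathbf{y}$; with $\min B_{1}<\min B_{2}$ put $\pi(\mathbf{x},\mathbf{y})=\max\{j\in B_{1}\mid j\leq i\text{ for all }i\in B_{2}\}$. Let $\mathscr{D}_{n}$ be the set of all maximal chains of $(NC_{n},\leq_{\mathrm{dref}})$ none of whose cover relations has label $\pi$ equal to $n-1$. The poset $(P\!E_{n},\leq_{\mathrm{pchn}})$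 is the subposet of $(NC_{n},\leq_{\mathrm{dref}})$ whose maximal chains are precisely the members of $\mathscr{D}_{n}$: its ground set is the union of all chains in $\mathscr{D}_{n}$ (it is known that this is exactly $P\!E_{n}$), and $\leq_{\mathrm{pchn}}$ is the reflexive-transitive closure of the cover relations between consecutive elements of chains in $\mathscr{D}_{n}$. It is bounded by $\mathbf{0}$ and $\mathbf{1}$. EL-labeling: an edge-labeling of a finite bounded poset $\mathcal{L}$ is a map $\lambda$ from its set of cover relations to some poset $(\Lambda,\prec)$. A saturated chain $x_{1}\lessdot\cdots\lessdot x_{k}$ has label sequence $(\lambda(x_{1},x_{2}),\ldots,\lambda(x_{k-1},x_{k}))$ and is rising if this sequence is strictly increasing with respect to $\prec$. $\lambda$ is an EL-labeling if for every interval $[x,y]$ of $\mathcal{L}$: (i) there is a unique rising maximal chain $C$ in $[x,y]$, and (ii) for every other maximal chain $C'$ of $[x,y]$ the label sequence of $C$ is lexicographically smaller than that of $C'$. A poset is EL-shellable (lexicographically shellable) if it admits an EL-labeling. *)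

theory Defs
  imports Main "HOL-Library.Disjoint_Sets"
begin

section \<open>Finite bounded posets and EL-labelings\<close>

text \<open>A poset is given by a carrier \<open>A\<close> and an order predicate \<open>le\<close>, of which only
  the restriction to \<open>A\<close> matters.\<close>

definition finite_bounded_poset :: "'a set \<Rightarrow> ('a \<Rightarrow> 'a \<Rightarrow> bool) \<Rightarrow> bool" where
  "finite_bounded_poset A le \<longleftrightarrow>
     finite A \<and> reflp_on A le \<and> transp_on A le \<and> antisymp_on A le \<and>
     (\<exists>b\<in>A. \<forall>x\<in>A. le b x) \<and> (\<exists>t\<in>A. \<forall>x\<in>A. le x t)"

definition interval :: "'a set \<Rightarrow> ('a \<Rightarrow> 'a \<Rightarrow> bool) \<Rightarrow> 'a \<Rightarrow> 'a \<Rightarrow> 'a set" where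
  "interval A le x y = {z \<in> A. le x z \<and> le z y}"

text \<open>The (finite) maximal chains, each listed in increasing order.\<close>

definition maximal_chains :: "'a set \<Rightarrow> ('a \<Rightarrow> 'a \<Rightarrow> bool) \<Rightarrow> 'a list set" where
  "maximal_chains A le =
     {c. sorted_wrt (\<lambda>x y. le x y \<and> x \<noteq> y) c \<and> pred_on.maxchain A le (set c)}"

definition steps :: "'a list \<Rightarrow> ('a \<times> 'a) list" where
  "steps c = zip c (tl c)"

definition label_seq :: "('a \<Rightarrow> 'a \<Rightarrow> 'l) \<Rightarrow> 'a list \<Rightarrow> 'l list" where
  "label_seq lam c = map (\<lambda>(x, y). lam x y) (steps c)"

text \<open>The labels form a poset with strict order \<open>lt\<close>. Consecutive elements of a maximal chain of
  an interval are cover relations, so the values of \<open>lam\<close> on other pairs are irrelevant.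
  On strict orders, \<^const>\<open>lexord\<close> compares two lists at the first position where they differ.\<close>

definition EL_labeling ::
  "'a set \<Rightarrow> ('a \<Rightarrow> 'a \<Rightarrow> bool) \<Rightarrow> ('a \<Rightarrow> 'a \<Rightarrow> 'l) \<Rightarrow> ('l \<Rightarrow> 'l \<Rightarrow> bool) \<Rightarrow> bool" where
  "EL_labeling A le lam lt \<longleftrightarrow>
     irreflp lt \<and> transp lt \<and>
     (\<forall>x\<in>A. \<forall>y\<in>A. le x y \<longrightarrow>
        (\<exists>c \<in> maximal_chains (interval A le x y) le.
           sorted_wrt lt (label_seq lam c) \<and>
           (\<forall>c' \<in> maximal_chains (interval A le x y) le.
              sorted_wrt lt (label_seq lam c') \<longrightarrow> c' = c) \<and>
           (\<forall>c' \<in> maximal_chains (interval A le x y) le. c' \<noteq> c \<longrightarrow>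
              (label_seq lam c, label_seq lam c') \<in> lexord {(a, b). lt a b})))"

text \<open>HOL cannot quantify existentially over the type of labels. A finite poset uses only finitely
  many labels, so taking an arbitrary strict partial order on \<^typ>\<open>nat\<close> loses nothing:
  see \<open>EL_shellableI\<close> below.\<close>

definition EL_shellable :: "'a set \<Rightarrow> ('a \<Rightarrow> 'a \<Rightarrow> bool) \<Rightarrow> bool" where
  "EL_shellable A le \<longleftrightarrow>
     finite_bounded_poset A le \<and>
     (\<exists>(lam :: 'a \<Rightarrow> 'a \<Rightarrow> nat) lt. EL_labeling A le lam lt)"

lemma maximal_chains_subset: "c \<in> maximal_chains A le \<Longrightarrow> set c \<subseteq> A"
  by (auto simp: maximal_chains_def pred_on.maxchain_def pred_on.chain_def)

lemma lexord_map:
  assumes "(xs, ys) \<in> lexord {(a, b). lt a b}"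
    and "\<And>a b. a \<in> set xs \<Longrightarrow> b \<in> set ys \<Longrightarrow> lt a b \<Longrightarrow> lt' (f a) (f b)"
  shows "(map f xs, map f ys) \<in> lexord {(a, b). lt' a b}"
  using assms
proof (induction xs arbitrary: ys)
  case Nil
  then show ?case by auto
next
  case (Cons x xs)
  then obtain y ys' where ys: "ys = y # ys'" by (cases ys) auto
  show ?case using Cons.prems Cons.IH[of ys'] unfolding ys by auto
qed

lemma EL_shellableI:
  fixes lam :: "'a \<Rightarrow> 'a \<Rightarrow> 'l"
  assumes P: "finite_bounded_poset A le" and EL: "EL_labeling A le lam lt"
  shows "EL_shellable A le"
proof -
  define L where "L = (\<lambda>(x, y). lam x y) ` (A \<times> A)"
  have "finite L" using P by (auto simp: L_def finite_bounded_poset_def)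
  then obtain f :: "'l \<Rightarrow> nat" where f: "inj_on f L"
    using finite_imp_inj_to_nat_seg by blast
  define lt' where "lt' a b \<longleftrightarrow> (\<exists>u\<in>L. \<exists>v\<in>L. a = f u \<and> b = f v \<and> lt u v)" for a b
  define lam' where "lam' x y = f (lam x y)" for x y
  have ord: "irreflp lt" "transp lt" using EL by (auto simp: EL_labeling_def)
  have lt': "lt' (f u) (f v) \<longleftrightarrow> lt u v" if "u \<in> L" "v \<in> L" for u v
    using that f by (auto simp: lt'_def inj_on_def)
  have irr: "irreflp lt'"
  proof (rule irreflpI)
    fix a show "\<not> lt' a a"
      using ord(1) f by (auto simp: lt'_def inj_on_def irreflp_def)
  qed
  have tr: "transp lt'"
  proof (rule transpI)
    fix a b c assume "lt' a b" "lt' b c"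
    then obtain u v v' w where L: "u \<in> L" "v \<in> L" "v' \<in> L" "w \<in> L"
      and eq: "a = f u" "b = f v" "b = f v'" "c = f w" and "lt u v" "lt v' w"
      unfolding lt'_def by blast
    moreover have "v = v'" using inj_onD[OF f] L eq by simp
    ultimately have "lt u w" using transpD[OF ord(2)] by blast
    then show "lt' a c" using lt' L eq by simp
  qed
  have map: "label_seq lam' c = map f (label_seq lam c)" for c
    by (auto simp: label_seq_def lam'_def)
  have sub: "set (label_seq lam c) \<subseteq> L" if c: "c \<in> maximal_chains (interval A le x y) le" for c x y
  proof -
    have "set c \<subseteq> A" using maximal_chains_subset[OF c] by (auto simp: interval_def)
    then have "set (steps c) \<subseteq> A \<times> A"
      using list.set_sel(2)[of c]
      by (cases "c = []") (auto simp: steps_def dest: set_zip_leftD set_zip_rightD)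
    then show ?thesis by (auto simp: label_seq_def L_def)
  qed
  have srt: "sorted_wrt lt' (label_seq lam' c) \<longleftrightarrow> sorted_wrt lt (label_seq lam c)"
    if c: "c \<in> maximal_chains (interval A le x y) le" for c x y
  proof -
    have "lt' (f u) (f v) \<longleftrightarrow> lt u v"
      if "u \<in> set (label_seq lam c)" "v \<in> set (label_seq lam c)" for u v
      using that sub[OF c] lt' by blast
    then have "sorted_wrt (\<lambda>u v. lt' (f u) (f v)) (label_seq lam c) \<longleftrightarrow>
        sorted_wrt lt (label_seq lam c)"
      by (simp add: sorted_wrt_iff_nth_less)
    then show ?thesis unfolding map sorted_wrt_map .
  qed
  have lex: "(label_seq lam' c, label_seq lam' c') \<in> lexord {(a, b). lt' a b}"
    if "(label_seq lam c, label_seq lam c') \<in> lexord {(a, b). lt a b}"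
      and c: "c \<in> maximal_chains (interval A le x y) le" "c' \<in> maximal_chains (interval A le x y) le"
    for c c' x y
    unfolding map using that(1)
    by (rule lexord_map) (use lt' sub[OF c(1)] sub[OF c(2)] in blast)
  have "EL_labeling A le lam' lt'"
    unfolding EL_labeling_def
  proof (intro conjI ballI impI irr tr)
    fix x y assume xy: "x \<in> A" "y \<in> A" "le x y"
    let ?M = "maximal_chains (interval A le x y) le"
    obtain c where c: "c \<in> ?M" and rising: "sorted_wrt lt (label_seq lam c)"
      and uniq: "\<forall>c'\<in>?M. sorted_wrt lt (label_seq lam c') \<longrightarrow> c' = c"
      and first: "\<forall>c'\<in>?M. c' \<noteq> c \<longrightarrow>
        (label_seq lam c, label_seq lam c') \<in> lexord {(a, b). lt a b}"
      using EL xy unfolding EL_labeling_def by blast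
    show "\<exists>c\<in>?M. sorted_wrt lt' (label_seq lam' c) \<and>
        (\<forall>c'\<in>?M. sorted_wrt lt' (label_seq lam' c') \<longrightarrow> c' = c) \<and>
        (\<forall>c'\<in>?M. c' \<noteq> c \<longrightarrow>
          (label_seq lam' c, label_seq lam' c') \<in> lexord {(a, b). lt' a b})"
    proof (intro bexI[OF _ c] conjI ballI impI)
      show "sorted_wrt lt' (label_seq lam' c)" using srt[OF c] rising by simp
    next
      fix c' assume "c' \<in> ?M" "sorted_wrt lt' (label_seq lam' c')"
      then show "c' = c" using srt uniq by simp
    next
      fix c' assume "c' \<in> ?M" "c' \<noteq> c"
      then show "(label_seq lam' c, label_seq lam' c') \<in> lexord {(a, b). lt' a b}"
        using lex[OF _ c] first by simp
    qed
  qed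
  then show ?thesis using P unfolding EL_shellable_def by blast
qed


section \<open>Noncrossing partitions and the poset of the parking labeling\<close>

definition same_block :: "'a set set \<Rightarrow> 'a \<Rightarrow> 'a \<Rightarrow> bool" where
  "same_block x i j \<longleftrightarrow> (\<exists>B\<in>x. i \<in> B \<and> j \<in> B)"

definition NC :: "nat \<Rightarrow> nat set set set" where
  "NC n = {x. partition_on {1..n} x \<and>
     (\<forall>i j k l. 1 \<le> i \<and> i < j \<and> j < k \<and> k < l \<and> l \<le> n \<and>
        same_block x i k \<and> same_block x j l \<longrightarrow> same_block x i j)}"

definition dref :: "'a set set \<Rightarrow> 'a set set \<Rightarrow> bool" where
  "dref x y \<longleftrightarrow> (\<forall>B\<in>x. \<exists>C\<in>y. B \<subseteq> C)"

definition PE :: "nat \<Rightarrow> nat set set set" where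
  "PE n = {x \<in> NC n. {n - 1, n} \<notin> x \<and> \<not> (same_block x 1 (n - 1) \<and> {n} \<in> x)}"

text \<open>Only meaningful if \<open>y\<close> covers \<open>x\<close> in \<^term>\<open>NC n\<close>, in which case \<open>B1\<close> and \<open>B2\<close> are unique.\<close>

definition parking_label :: "nat set set \<Rightarrow> nat set set \<Rightarrow> nat" where
  "parking_label x y =
     (THE m. \<exists>B1\<in>x. \<exists>B2\<in>x. B1 \<union> B2 \<in> y \<and> Min B1 < Min B2 \<and>
        m = Max {j \<in> B1. \<forall>i\<in>B2. j \<le> i})"

definition parking_chains :: "nat \<Rightarrow> nat set set list set" where
  "parking_chains n =
     {c \<in> maximal_chains (NC n) dref. n - 1 \<notin> set (label_seq parking_label c)}"

text \<open>The ground set of the poset is the union of the chains in \<^term>\<open>parking_chains n\<close>,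
  which is \<^term>\<open>PE n\<close>.\<close>

definition pchn :: "nat \<Rightarrow> nat set set \<Rightarrow> nat set set \<Rightarrow> bool" where
  "pchn n = (\<lambda>x y. \<exists>c\<in>parking_chains n. (x, y) \<in> set (steps c))\<^sup>*\<^sup>*"

end

theory Submission
  imports Defs
begin

text \<open>Compare elements of \<open>[n]\<close> by \<open>i mod n\<close>, so that \<open>n\<close> comes first, and label a cover relation
  by the block minimum that it removes. Along any maximal chain of an interval \<open>[x, y]\<close> of
  noncrossing partitions these labels are distinct, and they form the set of block minima of \<open>x\<close>
  that are not block minima of \<open>y\<close>. Hence the only rising chain is the greedy one, which
  always removes the least possible minimum, and it is lexicographically first. It remains to see
  that the greedy chain has no parking label \<open>n - 1\<close> whenever some chain of \<open>[x, y]\<close> has none.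
  The label \<open>n - 1\<close> means that the singleton \<open>{n}\<close> is merged with the block of \<open>n - 1\<close>. If the
  greedy chain does this, then in \<open>x\<close> the least \<open>p\<close> that lies with \<open>n\<close> in a block of \<open>y\<close> shares a
  block with \<open>n - 1\<close>; merging \<open>{n}\<close> with anything else would then produce a crossing, so every
  chain has the label \<open>n - 1\<close>.\<close>

section \<open>Graded posets whose edges add one label\<close>

lemma steps_Cons_Cons: "steps (a # b # c) = (a, b) # steps (b # c)"
  by (simp add: steps_def)

lemma label_seq_Cons: "c \<noteq> [] \<Longrightarrow> label_seq lam (a # c) = lam a (hd c) # label_seq lam c"
  by (cases c) (auto simp: label_seq_def steps_def)

lemma successively_iff_steps: "successively P c \<longleftrightarrow> (\<forall>(a, b) \<in> set (steps c). P a b)"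
  by (induction c rule: induct_list012) (auto simp: steps_def)

lemma rtranclp_iff_path:
  "R\<^sup>*\<^sup>* x y \<longleftrightarrow> (\<exists>c. c \<noteq> [] \<and> successively R c \<and> hd c = x \<and> last c = y)"
proof
  assume "R\<^sup>*\<^sup>* x y"
  then show "\<exists>c. c \<noteq> [] \<and> successively R c \<and> hd c = x \<and> last c = y"
  proof (induction rule: converse_rtranclp_induct)
    case base
    show ?case by (rule exI[of _ "[y]"]) simp
  next
    case (step x z)
    then obtain c where "c \<noteq> []" "successively R c" "hd c = z" "last c = y" by blast
    with step(1) show ?case by (intro exI[of _ "x # c"]) (auto simp: successively_Cons)
  qed
next
  have "c \<noteq> [] \<Longrightarrow> successively R c \<Longrightarrow> R\<^sup>*\<^sup>* (hd c) (last c)" for c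
    by (induction c rule: induct_list012) (auto intro: converse_rtranclp_into_rtranclp)
  then show "\<exists>c. c \<noteq> [] \<and> successively R c \<and> hd c = x \<and> last c = y \<Longrightarrow> R\<^sup>*\<^sup>* x y" by blast
qed

lemma step_on_path:
  assumes "(a, b) \<in> set (steps c)" "successively R c"
  shows "R\<^sup>*\<^sup>* (hd c) a \<and> R a b \<and> R\<^sup>*\<^sup>* b (last c)"
  using assms
proof (induction c rule: induct_list012)
  case (3 u v c)
  show ?case
  proof (cases "(a, b) = (u, v)")
    case True
    have "R\<^sup>*\<^sup>* v (last (v # c))"
      using 3 by (subst rtranclp_iff_path) (intro exI[of _ "v # c"], simp)
    then show ?thesis using True 3 by simp
  next
    case False
    then show ?thesis using 3
      by (auto simp: steps_Cons_Cons intro: converse_rtranclp_into_rtranclp)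
  qed
qed (auto simp: steps_def)

text \<open>Together with \<open>step_on_path\<close> this shows that the edges occurring on paths
  from \<open>x\<close> to \<open>y\<close> are those whose ends are reachable from \<open>x\<close>
  and reach \<open>y\<close>. In this form the steps of parking chains are computed later.\<close>

lemma path_through_edge:
  assumes "R\<^sup>*\<^sup>* x a" "R a b" "R\<^sup>*\<^sup>* b y"
  shows "\<exists>c. c \<noteq> [] \<and> successively R c \<and> hd c = x \<and> last c = y \<and> (a, b) \<in> set (steps c)"
proof -
  obtain c d where c: "c \<noteq> []" "successively R c" "hd c = x" "last c = a"
    and d: "d \<noteq> []" "successively R d" "hd d = b" "last d = y"
    using assms(1,3) unfolding rtranclp_iff_path by blast
  have "last e = a \<Longrightarrow> e \<noteq> [] \<Longrightarrow> (a, b) \<in> set (steps (e @ d))" for e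
    using d(1,3) by (induction e rule: induct_list012) (auto simp: steps_def neq_Nil_conv)
  then show ?thesis
    using c d assms(2) by (intro exI[of _ "c @ d"]) (auto simp: successively_append_iff)
qed

text \<open>\<open>E\<close> is meant as a cover relation and the size of \<open>M\<close> as a
  rank: an edge adds exactly one element to \<open>M\<close>, and this element will be the label.
  \<open>le\<close> is tied to \<open>E\<close> only inside \<open>A\<close>, since an order such as
  \<open>dref\<close> also compares sets outside the carrier. The two instances are
  \<open>dref\<close> on \<open>NC n\<close> and \<open>pchn n\<close> on \<open>PE n\<close>, both
  with \<open>nonmin n\<close> for \<open>M\<close>.\<close>

locale graded_edges =
  fixes A :: "'a set" and E le :: "'a \<Rightarrow> 'a \<Rightarrow> bool" and M :: "'a \<Rightarrow> nat set"
  assumes edge_in: "E x y \<Longrightarrow> x \<in> A \<and> y \<in> A"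
    and le_iff: "x \<in> A \<Longrightarrow> y \<in> A \<Longrightarrow> le x y \<longleftrightarrow> E\<^sup>*\<^sup>* x y"
    and finite_M: "x \<in> A \<Longrightarrow> finite (M x)"
    and edge_M: "E x y \<Longrightarrow> \<exists>l. l \<notin> M x \<and> M y = insert l (M x)"
begin

text \<open>On an edge the difference is a singleton, and \<open>Min\<close> only extracts its
  element.\<close>

definition new_label :: "'a \<Rightarrow> 'a \<Rightarrow> nat" where
  "new_label x y = Min (M y - M x)"

lemma edge_new_label:
  assumes "E x y"
  shows "new_label x y \<notin> M x \<and> M y = insert (new_label x y) (M x)"
proof -
  obtain l where l: "l \<notin> M x" "M y = insert l (M x)" using edge_M[OF assms] by blast
  then have "M y - M x = {l}" by blast
  then show ?thesis using l by (simp add: new_label_def)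
qed

lemma reachable_M: "E\<^sup>*\<^sup>* x y \<Longrightarrow> M x \<subseteq> M y \<and> (x \<noteq> y \<longrightarrow> M x \<subset> M y)"
proof (induction rule: rtranclp_induct)
  case (step y z)
  then have "M x \<subset> M z" using edge_M[of y z] by auto
  then show ?case by blast
qed simp

lemma reachable_in: "E\<^sup>*\<^sup>* x y \<Longrightarrow> x \<in> A \<Longrightarrow> y \<in> A"
  by (induction rule: rtranclp_induct) (simp_all add: edge_in)

lemma reachable_antisym: "E\<^sup>*\<^sup>* x y \<Longrightarrow> E\<^sup>*\<^sup>* y x \<Longrightarrow> x = y"
  using reachable_M by blast

text \<open>Otherwise \<open>M d\<close> would lie strictly between \<open>M a\<close> and
  \<open>M b\<close>, which differ in one element only.\<close>

lemma edge_cover: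
  assumes "E a b" "E\<^sup>*\<^sup>* a d" "E\<^sup>*\<^sup>* d b"
  shows "d = a \<or> d = b"
proof (rule ccontr)
  assume "\<not> (d = a \<or> d = b)"
  then have "M a \<subset> M d" "M d \<subset> M b" using assms(2,3) reachable_M by blast+
  moreover obtain l where "M b = insert l (M a)" using edge_M[OF assms(1)] by blast
  ultimately show False by (metis psubsetE subset_insert_iff insert_subset)
qed

lemma path_sorted: "successively E c \<Longrightarrow> sorted_wrt (\<lambda>x y. E\<^sup>*\<^sup>* x y \<and> x \<noteq> y) c"
proof (induction c rule: induct_list012)
  case (3 a b c)
  then have ab: "E\<^sup>*\<^sup>* a b" "a \<noteq> b" using edge_M[of a b] by auto
  have "E\<^sup>*\<^sup>* a v \<and> a \<noteq> v" if "v \<in> set (b # c)" for v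
  proof -
    have bv: "E\<^sup>*\<^sup>* b v" using 3 that by auto
    then have "E\<^sup>*\<^sup>* a v" using ab(1) by (rule rtranclp_trans[rotated])
    then show ?thesis using ab bv reachable_antisym by blast
  qed
  then show ?case using 3 by simp
qed simp_all

text \<open>Follow the path as long as its next vertex is still below \<open>d\<close>. At the first
  edge where this fails, \<open>d\<close> lies between the two ends, so it is one of them by
  \<open>edge_cover\<close>. Hence a path from \<open>x\<close> to \<open>y\<close> cannot be
  enlarged as a chain of the interval.\<close>

lemma comparable_mem_path:
  assumes "successively E c" "c \<noteq> []" "E\<^sup>*\<^sup>* (hd c) d" "E\<^sup>*\<^sup>* d (last c)"
    and "\<And>u. u \<in> set c \<Longrightarrow> E\<^sup>*\<^sup>* u d \<or> E\<^sup>*\<^sup>* d u"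
  shows "d \<in> set c"
  using assms
proof (induction c rule: induct_list012)
  case (2 x)
  then show ?case using reachable_antisym by auto
next
  case (3 a b c)
  show ?case
  proof (cases "E\<^sup>*\<^sup>* b d")
    case True
    then have "d \<in> set (b # c)" using 3 by (intro "3.IH"(2)) auto
    then show ?thesis by simp
  next
    case False
    then show ?thesis using 3 edge_cover[of a b d] by auto
  qed
qed simp

text \<open>This replaces the order-theoretic notion by lists that admit induction. A maximal chain
  contains the bounds \<open>x\<close> and \<open>y\<close> and, between consecutive members, leaves
  no room for a further vertex; conversely \<open>comparable_mem_path\<close> makes every path
  maximal.\<close>

lemma maximal_chains_interval:
  assumes x: "x \<in> A" and y: "y \<in> A" and xy: "E\<^sup>*\<^sup>* x y"
  shows "c \<in> maximal_chains (interval A le x y) le \<longleftrightarrow>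
    c \<noteq> [] \<and> successively E c \<and> hd c = x \<and> last c = y"
proof -
  let ?I = "interval A le x y"
  have I: "z \<in> ?I \<longleftrightarrow> E\<^sup>*\<^sup>* x z \<and> E\<^sup>*\<^sup>* z y" for z
    using x y le_iff reachable_in by (auto simp: interval_def)
  have IA: "z \<in> ?I \<Longrightarrow> z \<in> A" for z by (auto simp: interval_def)
  have chain: "pred_on.chain ?I le C \<longleftrightarrow> C \<subseteq> ?I \<and> (\<forall>u\<in>C. \<forall>v\<in>C. E\<^sup>*\<^sup>* u v \<or> E\<^sup>*\<^sup>* v u)" for C
  proof (cases "C \<subseteq> ?I")
    case True
    then have "u \<in> C \<Longrightarrow> v \<in> C \<Longrightarrow> le u v \<longleftrightarrow> E\<^sup>*\<^sup>* u v" for u v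
      using IA le_iff by blast
    then show ?thesis unfolding pred_on.chain_def by auto
  qed (simp add: pred_on.chain_def)
  show ?thesis
  proof
    assume c: "c \<in> maximal_chains ?I le"
    then have srt: "sorted_wrt (\<lambda>x y. le x y \<and> x \<noteq> y) c"
      and chn: "pred_on.chain ?I le (set c)"
      and maxi: "\<not> (\<exists>C. pred_on.chain ?I le C \<and> set c \<subset> C)"
      unfolding maximal_chains_def pred_on.maxchain_def by blast+
    have sub: "set c \<subseteq> ?I"
      and tot: "\<And>u v. u \<in> set c \<Longrightarrow> v \<in> set c \<Longrightarrow> E\<^sup>*\<^sup>* u v \<or> E\<^sup>*\<^sup>* v u"
      using chn unfolding chain by blast+
    have ins: "w \<in> set c" if "w \<in> ?I" "\<And>u. u \<in> set c \<Longrightarrow> E\<^sup>*\<^sup>* u w \<or> E\<^sup>*\<^sup>* w u" for w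
    proof -
      have "pred_on.chain ?I le (insert w (set c))"
        using that sub tot by (auto simp: chain)
      then show ?thesis using maxi by blast
    qed
    have xc: "x \<in> set c" and yc: "y \<in> set c"
      using sub I xy by (blast intro: ins)+
    then have ne: "c \<noteq> []" by auto
    have srt': "sorted_wrt (\<lambda>x y. E\<^sup>*\<^sup>* x y \<and> x \<noteq> y) c"
      by (rule sorted_wrt_mono_rel[OF _ srt]) (use sub IA le_iff in blast)
    have "hd c = x"
    proof (cases c)
      case (Cons a d)
      then have "E\<^sup>*\<^sup>* x a" using sub I by simp
      moreover have "x = a \<or> E\<^sup>*\<^sup>* a x" using srt' xc Cons by auto
      ultimately show ?thesis using reachable_antisym Cons by auto
    qed (use ne in simp)
    moreover have "last c = y"
    proof (cases c rule: rev_cases)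
      case (snoc d a)
      then have "E\<^sup>*\<^sup>* a y" using sub I by simp
      moreover have "y = a \<or> E\<^sup>*\<^sup>* y a" using srt' yc snoc by (auto simp: sorted_wrt_append)
      ultimately show ?thesis using reachable_antisym snoc by auto
    qed (use ne in simp)
    moreover have "successively E c"
      unfolding successively_conv_nth
    proof (intro allI impI)
      fix i assume i: "Suc i < length c"
      let ?a = "c ! i" and ?b = "c ! Suc i"
      have ab: "E\<^sup>*\<^sup>* ?a ?b" "?a \<noteq> ?b"
        using srt' i by (auto simp: sorted_wrt_iff_nth_less)
      \<comment> \<open>\<open>w\<close> is the first vertex after \<open>?a\<close> on some path to
        \<open>?b\<close>. It is comparable with every member of the chain, so maximality puts it
        into the chain, and strict sortedness leaves only the position of \<open>?b\<close>.\<close>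
      then obtain w where w: "E ?a w" "E\<^sup>*\<^sup>* w ?b" by (metis converse_rtranclpE)
      have aw: "E\<^sup>*\<^sup>* ?a w" using w(1) by blast
      have "?a \<in> ?I" "?b \<in> ?I" using sub i by auto
      then have "w \<in> ?I" using aw w(2) unfolding I by (meson rtranclp_trans)
      moreover have "E\<^sup>*\<^sup>* u w \<or> E\<^sup>*\<^sup>* w u" if u: "u \<in> set c" for u
      proof -
        obtain j where j: "j < length c" "u = c ! j" using u by (auto simp: in_set_conv_nth)
        consider "j < i" | "j = i" | "j = Suc i" | "Suc i < j" by linarith
        then show ?thesis
        proof cases
          case 1
          then have "E\<^sup>*\<^sup>* u ?a" using srt' i j by (auto simp: sorted_wrt_iff_nth_less)
          then show ?thesis using aw by (meson rtranclp_trans)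
        next
          case 4
          then have "E\<^sup>*\<^sup>* ?b u" using srt' i j by (auto simp: sorted_wrt_iff_nth_less)
          then show ?thesis using w(2) by (meson rtranclp_trans)
        qed (use aw w(2) j in auto)
      qed
      ultimately have "w \<in> set c" by (rule ins)
      then obtain j where j: "j < length c" "w = c ! j" by (auto simp: in_set_conv_nth)
      have lt: "E\<^sup>*\<^sup>* (c ! k) (c ! l) \<and> c ! k \<noteq> c ! l" if "k < l" "l < length c" for k l
        using srt' that by (auto simp: sorted_wrt_iff_nth_less)
      have "\<not> j < i" using lt[of j i] reachable_antisym[OF aw] i j by auto
      moreover have "j \<noteq> i" using edge_M[OF w(1)] j by auto
      moreover have "\<not> Suc i < j" using lt[of "Suc i" j] reachable_antisym[OF w(2)] j by auto
      ultimately have "w = ?b" using j by (metis Suc_lessI linorder_neqE_nat)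
      then show "E ?a ?b" using w(1) by simp
    qed
    ultimately show "c \<noteq> [] \<and> successively E c \<and> hd c = x \<and> last c = y" using ne by blast
  next
    assume c: "c \<noteq> [] \<and> successively E c \<and> hd c = x \<and> last c = y"
    then have srt: "sorted_wrt (\<lambda>x y. E\<^sup>*\<^sup>* x y \<and> x \<noteq> y) c" by (simp add: path_sorted)
    have tot: "E\<^sup>*\<^sup>* u v \<or> E\<^sup>*\<^sup>* v u" if uv: "u \<in> set c" "v \<in> set c" for u v
    proof -
      obtain i j where ij: "i < length c" "u = c ! i" "j < length c" "v = c ! j"
        using uv by (auto simp: in_set_conv_nth)
      then show ?thesis
        using srt by (cases i j rule: linorder_cases) (auto simp: sorted_wrt_iff_nth_less)
    qed
    have xu: "E\<^sup>*\<^sup>* x u" if "u \<in> set c" for u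
      using c srt that by (cases c) auto
    have uy: "E\<^sup>*\<^sup>* u y" if "u \<in> set c" for u
      using c srt that by (cases c rule: rev_cases) (auto simp: sorted_wrt_append)
    have sub: "set c \<subseteq> ?I" using xu uy I by blast
    have "sorted_wrt (\<lambda>x y. le x y \<and> x \<noteq> y) c"
      by (rule sorted_wrt_mono_rel[OF _ srt]) (use sub IA le_iff in blast)
    moreover have "pred_on.chain ?I le (set c)" using sub tot by (simp add: chain)
    moreover have "\<not> set c \<subset> C" if C: "pred_on.chain ?I le C" for C
    proof
      assume "set c \<subset> C"
      then obtain d where d: "d \<in> C" "d \<notin> set c" "set c \<subseteq> C" by blast
      have "d \<in> set c"
      proof (rule comparable_mem_path)
        show "E\<^sup>*\<^sup>* (hd c) d" "E\<^sup>*\<^sup>* d (last c)"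
          using C d(1) c I unfolding chain by auto
        show "E\<^sup>*\<^sup>* u d \<or> E\<^sup>*\<^sup>* d u" if "u \<in> set c" for u
          using C d that unfolding chain by blast
      qed (use c in auto)
      then show False using d by blast
    qed
    then have "\<not> (\<exists>C. pred_on.chain ?I le C \<and> set c \<subset> C)" by iprover
    ultimately show "c \<in> maximal_chains ?I le"
      unfolding maximal_chains_def pred_on.maxchain_def mem_Collect_eq by (intro conjI)
  qed
qed

text \<open>Each edge adds its label to \<open>M\<close> and removes nothing, so the labels account
  for all that \<open>M\<close> gains along the path.\<close>

lemma set_label_seq_path:
  "c \<noteq> [] \<Longrightarrow> successively E c \<Longrightarrow> set (label_seq new_label c) = M (last c) - M (hd c)"
proof (induction c rule: induct_list012)
  case (3 a b c)
  have "M b \<subseteq> M (last (b # c))"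
    using 3 by (intro reachable_M[THEN conjunct1]) (subst rtranclp_iff_path, intro exI[of _ "b # c"], simp)
  then show ?case using 3 edge_new_label[of a b] by (auto simp: label_seq_Cons)
qed (auto simp: label_seq_def steps_def)

text \<open>All paths from \<open>x\<close> to \<open>y\<close> carry the same label set
  \<open>M y - M x\<close>. The assumption provides a unique first edge labeled by its minimum.
  Taking that edge and recursing, by induction on the number of labels still missing, yields the
  rising path; any other path has a larger label where it first departs from it.\<close>

theorem EL_labeling_new_label:
  assumes first_edge: "\<And>x y. x \<in> A \<Longrightarrow> E\<^sup>*\<^sup>* x y \<Longrightarrow> x \<noteq> y \<Longrightarrow>
      \<exists>z. E x z \<and> E\<^sup>*\<^sup>* z y \<and> new_label x z = Min (M y - M x) \<and>
        (\<forall>z'. E x z' \<and> E\<^sup>*\<^sup>* z' y \<and> new_label x z' = new_label x z \<longrightarrow> z' = z)"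
  shows "EL_labeling A le new_label (<)"
proof -
  let ?L = "label_seq new_label"
  let ?path = "\<lambda>x y c. c \<noteq> [] \<and> successively E c \<and> hd c = x \<and> last c = y"
  have main: "\<exists>c. ?path x y c \<and> sorted_wrt (<) (?L c) \<and>
      (\<forall>c'. ?path x y c' \<and> sorted_wrt (<) (?L c') \<longrightarrow> c' = c) \<and>
      (\<forall>c'. ?path x y c' \<and> c' \<noteq> c \<longrightarrow> (?L c, ?L c') \<in> lexord {(a, b). a < b})"
    if "x \<in> A" "E\<^sup>*\<^sup>* x y" for x y
    using that
  proof (induction "card (M y - M x)" arbitrary: x rule: less_induct)
    case less
    have yA: "y \<in> A" using reachable_in[OF less.prems(2,1)] .
    show ?case
    proof (cases "x = y")
      case True
      have "c = [x]" if "?path x y c" for c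
      proof (cases c)
        case (Cons a d)
        have "d = []"
        proof (rule ccontr)
          assume "d \<noteq> []"
          then have "y \<in> set d" using that Cons by (metis last_ConsR last_in_set)
          moreover have "successively E (a # d)" using that Cons by blast
          then have "\<forall>v\<in>set d. a \<noteq> v" using path_sorted by fastforce
          ultimately show False using that Cons True by simp
        qed
        then show ?thesis using Cons that by simp
      qed (use that in simp)
      then show ?thesis using True
        by (intro exI[of _ "[x]"]) (auto simp: label_seq_def steps_def)
    next
      case False
      then obtain z where z: "E x z" "E\<^sup>*\<^sup>* z y" "new_label x z = Min (M y - M x)"
        and uniq: "\<And>z'. E x z' \<Longrightarrow> E\<^sup>*\<^sup>* z' y \<Longrightarrow> new_label x z' = new_label x z \<Longrightarrow> z' = z"
        using first_edge[OF less.prems False] by blast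
      let ?m = "new_label x z"
      have m: "?m \<notin> M x" "M z = insert ?m (M x)" using edge_new_label z(1) by auto
      have My: "finite (M y)" "M z \<subseteq> M y" using finite_M[OF yA] reachable_M[OF z(2)] by auto
      have m_le: "?m \<le> l" if "l \<in> M y - M x" for l using that z(3) My by auto
      have "card (M y - M z) < card (M y - M x)"
        using m My by (intro psubset_card_mono) auto
      moreover have "z \<in> A" using edge_in z(1) by blast
      ultimately obtain d where d: "?path z y d" "sorted_wrt (<) (?L d)"
        and d1: "\<And>d'. ?path z y d' \<Longrightarrow> sorted_wrt (<) (?L d') \<Longrightarrow> d' = d"
        and d2: "\<And>d'. ?path z y d' \<Longrightarrow> d' \<noteq> d \<Longrightarrow> (?L d, ?L d') \<in> lexord {(a, b). a < b}"
        using less.hyps[OF _ _ z(2)] by blast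
      have setd: "set (?L d) = M y - M z" using set_label_seq_path[of d] d(1) by simp
      have decomp: "\<exists>w c. c' = x # c \<and> ?path w y c \<and> E x w \<and> E\<^sup>*\<^sup>* w y \<and>
          ?L c' = new_label x w # ?L c \<and> set (?L c') = M y - M x" if c': "?path x y c'" for c'
      proof -
        obtain c where c: "c' = x # c" using c' by (metis list.collapse)
        then have c_ne: "c \<noteq> []" using c' False by auto
        then have "?path (hd c) y c" "E x (hd c)" using c c' by (auto simp: successively_Cons)
        moreover from this have "E\<^sup>*\<^sup>* (hd c) y" unfolding rtranclp_iff_path by blast
        ultimately show ?thesis
          using c c_ne c' set_label_seq_path[of c'] by (auto simp: label_seq_Cons)
      qed
      have Lx: "?L (x # d) = ?m # ?L d" using d(1) by (auto simp: label_seq_Cons)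
      show ?thesis
      proof (intro exI[of _ "x # d"] conjI allI impI)
        show "successively E (x # d)" "last (x # d) = y"
          using d(1) z(1) by (auto simp: successively_Cons)
        show "sorted_wrt (<) (?L (x # d))"
          unfolding Lx using d(2) setd m_le m by (auto simp: le_less)
      next
        fix c' assume c': "?path x y c' \<and> sorted_wrt (<) (?L c')"
        then obtain w c where w: "c' = x # c" "?path w y c" "E x w" "E\<^sup>*\<^sup>* w y"
          "?L c' = new_label x w # ?L c" "set (?L c') = M y - M x"
          using decomp by blast
        \<comment> \<open>The least label has to occur somewhere on \<open>c'\<close>, and on a
          rising path it can only come first.\<close>
        have "?m \<in> set (?L c')" using w(6) m My by auto
        then have "new_label x w \<le> ?m" using c' w(5) by auto
        moreover have "new_label x w \<in> M y - M x" using w(5,6) by auto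
        ultimately have "w = z" using m_le uniq w by (meson le_antisym)
        then show "c' = x # d" using d1[of c] w c' by auto
      next
        fix c' assume c': "?path x y c' \<and> c' \<noteq> x # d"
        then obtain w c where w: "c' = x # c" "?path w y c" "E x w" "E\<^sup>*\<^sup>* w y"
          "?L c' = new_label x w # ?L c" "set (?L c') = M y - M x"
          using decomp by blast
        show "(?L (x # d), ?L c') \<in> lexord {(a, b). a < b}"
        proof (cases "w = z")
          case True
          then show ?thesis using d2[of c] w c' Lx by auto
        next
          case False
          have "new_label x w \<in> M y - M x" using w(5,6) by auto
          then have "?m < new_label x w" using False m_le uniq w by (metis le_less)
          then show ?thesis using w(5) Lx by auto
        qed
      qed simp_all
    qed
  qed
  show ?thesis
    unfolding EL_labeling_def
  proof (intro conjI ballI impI)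
    show "irreflp ((<) :: nat \<Rightarrow> nat \<Rightarrow> bool)" "transp ((<) :: nat \<Rightarrow> nat \<Rightarrow> bool)" by auto
  next
    fix x y assume xy: "x \<in> A" "y \<in> A" "le x y"
    then have r: "E\<^sup>*\<^sup>* x y" using le_iff by blast
    show "\<exists>c\<in>maximal_chains (interval A le x y) le. sorted_wrt (<) (?L c) \<and>
        (\<forall>c'\<in>maximal_chains (interval A le x y) le. sorted_wrt (<) (?L c') \<longrightarrow> c' = c) \<and>
        (\<forall>c'\<in>maximal_chains (interval A le x y) le. c' \<noteq> c \<longrightarrow>
          (?L c, ?L c') \<in> lexord {(a, b). a < b})"
      using main[OF xy(1) r] unfolding Bex_def Ball_def maximal_chains_interval[OF xy(1,2) r]
      by blast
  qed
qed

end

section \<open>Noncrossing partitions, with \<open>n\<close> as the least element\<close>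

lemma block_unique: "partition_on S x \<Longrightarrow> B \<in> x \<Longrightarrow> C \<in> x \<Longrightarrow> i \<in> B \<Longrightarrow> i \<in> C \<Longrightarrow> B = C"
  by (auto simp: partition_on_def disjoint_def)

lemma block_nonempty: "partition_on S x \<Longrightarrow> B \<in> x \<Longrightarrow> \<exists>i. i \<in> B"
  unfolding partition_on_def by (metis ex_in_conv)

lemma same_block_refl: "partition_on S x \<Longrightarrow> i \<in> S \<Longrightarrow> same_block x i i"
  by (auto simp: partition_on_def same_block_def)

lemma same_block_in: "partition_on S x \<Longrightarrow> same_block x i j \<Longrightarrow> i \<in> S \<and> j \<in> S"
  by (auto simp: partition_on_def same_block_def)

lemma same_block_sym: "same_block x i j \<Longrightarrow> same_block x j i"
  by (auto simp: same_block_def)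

lemma same_block_trans:
  assumes "partition_on S x" "same_block x i j" "same_block x j k"
  shows "same_block x i k"
proof -
  obtain B C where B: "B \<in> x" "i \<in> B" "j \<in> B" and C: "C \<in> x" "j \<in> C" "k \<in> C"
    using assms(2,3) by (auto simp: same_block_def)
  then have "B = C" using block_unique[OF assms(1)] by metis
  then show ?thesis using B C by (auto simp: same_block_def)
qed

lemma same_block_iff:
  assumes "partition_on S x" "B \<in> x" "i \<in> B"
  shows "same_block x i j \<longleftrightarrow> j \<in> B"
  unfolding same_block_def using assms block_unique by metis

lemma dref_same_block: "dref x y \<Longrightarrow> same_block x i j \<Longrightarrow> same_block y i j"
  unfolding dref_def same_block_def by (meson subsetD)

text \<open>From here on refinement can be treated as inclusion of equivalence relations, without
  naming blocks.\<close>

lemma dref_iff_same_block: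
  assumes "partition_on S x" "partition_on S y"
  shows "dref x y \<longleftrightarrow> (\<forall>i j. same_block x i j \<longrightarrow> same_block y i j)"
proof
  assume r: "\<forall>i j. same_block x i j \<longrightarrow> same_block y i j"
  show "dref x y"
    unfolding dref_def
  proof
    fix B assume B: "B \<in> x"
    then obtain i where i: "i \<in> B" using block_nonempty[OF assms(1)] by blast
    then have "same_block x i i" using B by (auto simp: same_block_def)
    then have "same_block y i i" using r by blast
    then obtain C where C: "C \<in> y" "i \<in> C" by (auto simp: same_block_def)
    have "j \<in> C" if "j \<in> B" for j
    proof -
      have "same_block x i j" using that B i by (auto simp: same_block_def)
      then show ?thesis using r same_block_iff[OF assms(2) C] by blast
    qed
    then show "\<exists>C\<in>y. B \<subseteq> C" using C by blast
  qed
qed (metis dref_same_block)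

lemma dref_refl: "dref x x"
  by (auto simp: dref_def)

lemma dref_trans: "dref x y \<Longrightarrow> dref y z \<Longrightarrow> dref x z"
  unfolding dref_def by (meson subset_trans)

lemma dref_antisym:
  assumes "partition_on S x" "partition_on S y" "dref x y" "dref y x"
  shows "x = y"
proof -
  have "u \<subseteq> v" if p: "partition_on S u" and uv: "dref u v" "dref v u" for u v :: "'a set set"
  proof
    fix B assume B: "B \<in> u"
    obtain C where C: "C \<in> v" "B \<subseteq> C" using uv(1) B by (auto simp: dref_def)
    obtain D where D: "D \<in> u" "C \<subseteq> D" using uv(2) C by (auto simp: dref_def)
    obtain i where "i \<in> B" using block_nonempty[OF p B] by blast
    then have "B = D" using block_unique[OF p B D(1)] C(2) D(2) by blast
    then show "B \<in> v" using C D by auto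
  qed
  then show ?thesis using assms by blast
qed

lemma singleton_block_iff:
  assumes "partition_on S x"
  shows "{i} \<in> x \<longleftrightarrow> i \<in> S \<and> (\<forall>j. same_block x i j \<longrightarrow> j = i)"
proof
  assume "{i} \<in> x"
  then show "i \<in> S \<and> (\<forall>j. same_block x i j \<longrightarrow> j = i)"
    using same_block_iff[OF assms, of "{i}" i] assms by (auto simp: partition_on_def)
next
  assume r: "i \<in> S \<and> (\<forall>j. same_block x i j \<longrightarrow> j = i)"
  then obtain B where B: "B \<in> x" "i \<in> B" using assms by (auto simp: partition_on_def)
  then have "B = {i}" using r by (auto simp: same_block_def)
  then show "{i} \<in> x" using B by simp
qed

text \<open>The two blocks are given by representatives, so that block minima can be used directly.
  Whether the result is noncrossing is a separate question, settled in
  \<open>merge_in_NC\<close>.\<close>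

definition merge :: "'a set set \<Rightarrow> 'a \<Rightarrow> 'a \<Rightarrow> 'a set set" where
  "merge x a b = {B \<in> x. a \<notin> B \<and> b \<notin> B} \<union> {\<Union>{B \<in> x. a \<in> B \<or> b \<in> B}}"

lemma partition_on_merge:
  assumes p: "partition_on S x" and a: "a \<in> S"
  shows "partition_on S (merge x a b)"
proof (rule partition_onI)
  let ?U = "\<Union>{B \<in> x. a \<in> B \<or> b \<in> B}"
  have D: "D = ?U \<or> D \<in> x \<and> a \<notin> D \<and> b \<notin> D" if "D \<in> merge x a b" for D
    using that by (auto simp: merge_def)
  have "\<Union>(merge x a b) = \<Union>x" unfolding merge_def by blast
  then show "\<Union>(merge x a b) = S" using partition_onD1[OF p] by simp
  show "disjnt B C" if BC: "B \<in> merge x a b" "C \<in> merge x a b" "B \<noteq> C" for B C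
  proof (rule ccontr)
    assume "\<not> disjnt B C"
    then obtain i where i: "i \<in> B" "i \<in> C" by (auto simp: disjnt_def)
    show False
      using D[OF BC(1)] D[OF BC(2)] BC(3) i block_unique[OF p] by blast
  qed
  obtain X where "X \<in> x" "a \<in> X" using assms by (auto simp: partition_on_def)
  then have "?U \<noteq> {}" by blast
  then show "{} \<notin> merge x a b" using D[of "{}"] partition_onD3[OF p] by metis
qed

lemma same_block_merge:
  assumes p: "partition_on S x"
  shows "same_block (merge x a b) i j \<longleftrightarrow> same_block x i j \<or>
    (same_block x a i \<or> same_block x b i) \<and> (same_block x a j \<or> same_block x b j)"
    (is "_ \<longleftrightarrow> _ \<or> ?U i \<and> ?U j")
proof -
  have U: "k \<in> \<Union>{B \<in> x. a \<in> B \<or> b \<in> B} \<longleftrightarrow> ?U k" for k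
    by (auto simp: same_block_def)
  have "same_block (merge x a b) i j \<longleftrightarrow>
      (\<exists>B\<in>x. a \<notin> B \<and> b \<notin> B \<and> i \<in> B \<and> j \<in> B) \<or> ?U i \<and> ?U j"
    unfolding U[symmetric] by (simp add: same_block_def merge_def) blast
  also have "\<dots> \<longleftrightarrow> same_block x i j \<or> ?U i \<and> ?U j"
  proof -
    have "?U i \<and> ?U j" if "B \<in> x" "i \<in> B" "j \<in> B" "a \<in> B \<or> b \<in> B" for B
      using that by (auto simp: same_block_def)
    then show ?thesis unfolding same_block_def[of x i j] by blast
  qed
  finally show ?thesis .
qed

section \<open>Noncrossing partitions and block minima in the rotated order\<close>

lemma mod_inj: "i \<in> {1..n} \<Longrightarrow> j \<in> {1..n} \<Longrightarrow> i mod n = j mod n \<Longrightarrow> i = (j :: nat)"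
  by (cases "i = n"; cases "j = n") auto

lemma NC_partition: "x \<in> NC n \<Longrightarrow> partition_on {1..n} x"
  by (simp add: NC_def)

text \<open>Crossing depends only on the cyclic order. The case that differs from the definition is
  \<open>i = n\<close>: then \<open>j < k < l < i\<close> in the usual order, and the condition is
  applied to the rotated quadruple. \<open>NC_I_mod\<close> is the converse, with the rotation
  undone when \<open>l = n\<close>.\<close>

lemma NC_noncrossing_mod:
  assumes x: "x \<in> NC n" and ik: "same_block x i k" and jl: "same_block x j l"
    and lt: "i mod n < j mod n" "j mod n < k mod n" "k mod n < l mod n"
  shows "same_block x i j"
proof -
  note p = NC_partition[OF x]
  have mem: "i \<in> {1..n}" "j \<in> {1..n}" "k \<in> {1..n}" "l \<in> {1..n}"
    using same_block_in[OF p] ik jl by auto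
  have nc: "same_block x i j" if "i < j" "j < k" "k < l" "same_block x i k" "same_block x j l" for i j k l
  proof -
    have "1 \<le> i" "l \<le> n" using that(4,5) same_block_in[OF p] by auto
    then show ?thesis using x that unfolding NC_def by blast
  qed
  have "j \<noteq> n" "k \<noteq> n" "l \<noteq> n" using lt by auto
  then have jkl: "j mod n = j" "k mod n = k" "l mod n = l" using mem by auto
  show ?thesis
  proof (cases "i = n")
    case True
    then have "l < i" using mem \<open>l \<noteq> n\<close> by auto
    then have "same_block x j k" using nc[of j k l i] lt jkl same_block_sym[OF ik] jl by auto
    then show ?thesis by (rule same_block_trans[OF p ik same_block_sym])
  next
    case False
    then have "i mod n = i" using mem by auto
    then show ?thesis using nc lt jkl ik jl by auto
  qed
qed

lemma NC_I_mod:
  assumes p: "partition_on {1..n} x"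
    and nc: "\<And>i j k l. same_block x i k \<Longrightarrow> same_block x j l \<Longrightarrow>
      i mod n < j mod n \<Longrightarrow> j mod n < k mod n \<Longrightarrow> k mod n < l mod n \<Longrightarrow> same_block x i j"
  shows "x \<in> NC n"
  unfolding NC_def
proof (intro CollectI conjI p allI impI)
  fix i j k l :: nat
  assume a: "1 \<le> i \<and> i < j \<and> j < k \<and> k < l \<and> l \<le> n \<and> same_block x i k \<and> same_block x j l"
  then have ijk: "i mod n = i" "j mod n = j" "k mod n = k" by auto
  show "same_block x i j"
  proof (cases "l = n")
    case True
    have lj: "same_block x l j" using a by (auto intro: same_block_sym[of x j l])
    have "same_block x l i"
      by (rule nc[OF lj, of i k]) (use True a ijk in simp_all)
    then have "same_block x i l" by (rule same_block_sym)
    then show ?thesis by (rule same_block_trans[OF p _ lj])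
  next
    case False
    then have "l mod n = l" using a by auto
    show ?thesis by (rule nc[of i k j l]) (use \<open>l mod n = l\<close> a ijk in simp_all)
  qed
qed

text \<open>Via \<open>i \<mapsto> i mod n\<close> the element \<open>n\<close> is moved to the front; this is a rotation, so it
  preserves noncrossing partitions. Merging two blocks removes exactly one block minimum.\<close>

definition nonmin :: "nat \<Rightarrow> nat set set \<Rightarrow> nat set" where
  "nonmin n x = {k mod n | k. \<exists>j. same_block x j k \<and> j mod n < k mod n}"

lemma nonminI: "same_block x j k \<Longrightarrow> j mod n < k mod n \<Longrightarrow> k mod n \<in> nonmin n x"
  unfolding nonmin_def by blast

lemma finite_nonmin: "x \<in> NC n \<Longrightarrow> finite (nonmin n x)"
proof -
  assume "x \<in> NC n"
  then have "nonmin n x \<subseteq> (\<lambda>k. k mod n) ` {1..n}"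
    using same_block_in[OF NC_partition] unfolding nonmin_def by blast
  then show ?thesis using finite_surj by blast
qed

lemma nonmin_mono:
  assumes "dref x y"
  shows "nonmin n x \<subseteq> nonmin n y"
  unfolding nonmin_def using dref_same_block[OF assms] by blast

lemma mem_nonmin_iff:
  assumes "x \<in> NC n" "k \<in> {1..n}"
  shows "k mod n \<in> nonmin n x \<longleftrightarrow> (\<exists>j. same_block x j k \<and> j mod n < k mod n)"
proof
  assume "k mod n \<in> nonmin n x"
  then obtain k' j where k': "k mod n = k' mod n" "same_block x j k'" "j mod n < k' mod n"
    by (auto simp: nonmin_def)
  then have "k = k'"
    using mod_inj[of k n k'] assms same_block_in[OF NC_partition[OF assms(1)]] by blast
  then show "\<exists>j. same_block x j k \<and> j mod n < k mod n" using k' by auto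
qed (auto simp: nonmin_def)

lemma block_min:
  assumes x: "x \<in> NC n" and i: "i \<in> {1..n}"
  obtains a where "same_block x a i" "a mod n \<notin> nonmin n x"
    "\<And>j. same_block x j i \<Longrightarrow> a mod n \<le> j mod n"
proof -
  note p = NC_partition[OF x]
  obtain a where a: "same_block x a i" "\<And>j. same_block x j i \<Longrightarrow> a mod n \<le> j mod n"
    using ex_has_least_nat[of "\<lambda>j. same_block x j i" i "\<lambda>j. j mod n"] same_block_refl[OF p i] by blast
  have "a \<in> {1..n}" using same_block_in[OF p a(1)] by blast
  then have "a mod n \<notin> nonmin n x"
    using a same_block_trans[OF p _ a(1)] mem_nonmin_iff[OF x] by (meson not_less)
  then show ?thesis using that a by blast
qed

lemma le_if_not_nonmin:
  assumes x: "x \<in> NC n" and a: "a mod n \<notin> nonmin n x" "same_block x a i"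
  shows "a mod n \<le> i mod n"
proof -
  have "a \<in> {1..n}" using same_block_in[OF NC_partition[OF x] a(2)] by blast
  then show ?thesis using mem_nonmin_iff[OF x] a same_block_sym[OF a(2)] by (meson not_less)
qed

lemma not_nonmin_unique:
  assumes x: "x \<in> NC n" and ab: "same_block x a b" "a mod n \<notin> nonmin n x" "b mod n \<notin> nonmin n x"
  shows "a = b"
proof -
  have "a mod n = b mod n"
    using le_if_not_nonmin[OF x ab(2,1)] le_if_not_nonmin[OF x ab(3) same_block_sym[OF ab(1)]]
    by (rule le_antisym)
  then show ?thesis using same_block_in[OF NC_partition[OF x] ab(1)] mod_inj by blast
qed

text \<open>If \<open>i\<close> and \<open>j\<close> share a block of \<open>y\<close>, pass to the
  minima of their blocks in \<open>x\<close>. These are still minima in \<open>y\<close> and share a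
  block there, so they coincide. Thus \<open>nonmin n\<close> increases strictly along
  \<open>dref\<close>.\<close>

lemma nonmin_inj:
  assumes x: "x \<in> NC n" and y: "y \<in> NC n" and "dref x y" "nonmin n x = nonmin n y"
  shows "x = y"
proof -
  note px = NC_partition[OF x] and py = NC_partition[OF y]
  have "same_block x i j" if ij: "same_block y i j" for i j
  proof -
    have "i \<in> {1..n}" "j \<in> {1..n}" using same_block_in[OF py ij] by auto
    then obtain a b where a: "same_block x a i" "a mod n \<notin> nonmin n x"
      and b: "same_block x b j" "b mod n \<notin> nonmin n x"
      using block_min[OF x] by metis
    have "same_block y a b"
      using same_block_trans[OF py same_block_trans[OF py _ ij]] same_block_sym
        dref_same_block[OF assms(3) a(1)] dref_same_block[OF assms(3) b(1)] by metis
    then have "a = b" using not_nonmin_unique[OF y] a b assms(4) by auto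
    then show ?thesis using same_block_trans[OF px same_block_sym[OF a(1)]] b(1) by simp
  qed
  then have "dref y x" using dref_iff_same_block[OF py px] by blast
  then show ?thesis using dref_antisym[OF px py] assms by blast
qed

text \<open>Of the two block minima the smaller one, \<open>a\<close>, stays a minimum and
  \<open>m\<close> ceases to be one; all other blocks are unchanged.\<close>

lemma nonmin_merge:
  assumes x: "x \<in> NC n" and "a \<in> {1..n}" "m \<in> {1..n}" and lt: "a mod n < m mod n"
    and a: "a mod n \<notin> nonmin n x" and m: "m mod n \<notin> nonmin n x"
  shows "nonmin n (merge x a m) = insert (m mod n) (nonmin n x)"
proof -
  note p = NC_partition[OF x]
  note sb = same_block_merge[OF p, of a m]
  have am: "same_block x a a" "same_block x m m" using same_block_refl[OF p] assms by auto
  show ?thesis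
  proof (intro equalityI subsetI)
    fix r assume "r \<in> nonmin n (merge x a m)"
    then obtain j k where r: "r = k mod n" and jk: "same_block (merge x a m) j k" "j mod n < k mod n"
      by (auto simp: nonmin_def)
    from jk(1) consider "same_block x j k" | "same_block x m k"
      | "same_block x a k" "same_block x a j \<or> same_block x m j"
      unfolding sb by blast
    then show "r \<in> insert (m mod n) (nonmin n x)"
    proof cases
      case 1
      then show ?thesis using nonminI jk r by blast
    next
      case 2
      then have "m mod n \<le> k mod n" using le_if_not_nonmin[OF x m] by blast
      then show ?thesis using nonminI[OF 2] r by (cases "m mod n = k mod n") auto
    next
      case 3
      then have "a mod n \<le> j mod n"
        using le_if_not_nonmin[OF x a, of j] le_if_not_nonmin[OF x m, of j] lt by auto
      then show ?thesis using nonminI[OF 3(1)] r jk(2) by auto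
    qed
  next
    fix r assume r: "r \<in> insert (m mod n) (nonmin n x)"
    have "same_block (merge x a m) a m" unfolding sb using am by blast
    then have "m mod n \<in> nonmin n (merge x a m)" using lt by (rule nonminI)
    moreover have "nonmin n x \<subseteq> nonmin n (merge x a m)" unfolding nonmin_def sb by blast
    ultimately show "r \<in> nonmin n (merge x a m)" using r by blast
  qed
qed

text \<open>Suppose the merged block crosses another block of \<open>x\<close>. As \<open>y\<close>
  is noncrossing, both lie in the \<open>y\<close>-block of \<open>a\<close>. By the choice of
  \<open>m\<close>, the elements of the other block come after both \<open>a\<close> and
  \<open>m\<close>, so one of the two original blocks already crosses it in
  \<open>x\<close>.\<close>

lemma merge_in_NC:
  assumes x: "x \<in> NC n" and y: "y \<in> NC n" and xy: "dref x y"
    and am: "same_block y a m" "a mod n < m mod n"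
    and a: "a mod n \<notin> nonmin n y" and m: "m mod n \<notin> nonmin n x"
    and least: "\<And>l. l \<in> nonmin n y - nonmin n x \<Longrightarrow> m mod n \<le> l"
  shows "merge x a m \<in> NC n"
proof (rule NC_I_mod)
  note px = NC_partition[OF x] and py = NC_partition[OF y]
  note sb = same_block_merge[OF px, of a m]
  have mem: "a \<in> {1..n}" "m \<in> {1..n}" using same_block_in[OF py am(1)] by auto
  then show "partition_on {1..n} (merge x a m)" using partition_on_merge[OF px] by blast
  let ?U = "\<lambda>i. same_block x a i \<or> same_block x m i"
  have U_y: "same_block y a i" if "?U i" for i
    using that dref_same_block[OF xy] same_block_trans[OF py am(1)] by blast
  \<comment> \<open>Outside the merged blocks, every block minimum of \<open>x\<close> in the \<open>y\<close>-block of \<open>a\<close> exceeds \<open>m\<close>.\<close>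
  have gt: "m mod n < i mod n" if "same_block y a i" "\<not> ?U i" for i
  proof -
    have "i \<in> {1..n}" using same_block_in[OF py that(1)] by blast
    then obtain b where b: "same_block x b i" "b mod n \<notin> nonmin n x"
      "\<And>j. same_block x j i \<Longrightarrow> b mod n \<le> j mod n"
      using block_min[OF x] by blast
    have bi: "same_block y a b"
      by (rule same_block_trans[OF py that(1) same_block_sym[OF dref_same_block[OF xy b(1)]]])
    have "b \<noteq> a" "b \<noteq> m" using b(1) that(2) by auto
    then have "b mod n \<in> nonmin n y" using not_nonmin_unique[OF y bi a] by blast
    then have "m mod n \<le> b mod n" using least b(2) by blast
    moreover have "m mod n \<noteq> b mod n"
      using mod_inj[OF mem(2)] same_block_in[OF py bi] \<open>b \<noteq> m\<close> by blast
    moreover have "b mod n \<le> i mod n"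
      using le_if_not_nonmin[OF x b(2) b(1)] .
    ultimately show ?thesis by linarith
  qed
  fix i j k l
  assume ik: "same_block (merge x a m) i k" and jl: "same_block (merge x a m) j l"
    and lt: "i mod n < j mod n" "j mod n < k mod n" "k mod n < l mod n"
  have to_y: "same_block y u v" if "same_block (merge x a m) u v" for u v
    using that unfolding sb
    using dref_same_block[OF xy, of u v] same_block_trans[OF py same_block_sym[OF U_y[of u]] U_y[of v]]
    by blast
  have yij: "same_block y i j"
    using NC_noncrossing_mod[OF y to_y[OF ik] to_y[OF jl] lt] .
  have "?U i \<and> ?U j \<or> same_block x i j"
  proof (rule ccontr)
    assume no: "\<not> ?thesis"
    consider "same_block x i k" "same_block x j l" | "?U i" "?U k" "same_block x j l" "\<not> ?U j"
      | "?U j" "?U l" "same_block x i k" "\<not> ?U i"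
      using ik jl no unfolding sb by blast
    then show False
    proof cases
      case 1
      then show False using NC_noncrossing_mod[OF x 1 lt] no by blast
    next
      \<comment> \<open>Both \<open>a\<close> and \<open>m\<close> come before \<open>j\<close>;
        whichever shares its \<open>x\<close>-block with \<open>k\<close> takes the place of
        \<open>i\<close>.\<close>
      case 2
      then have "m mod n < j mod n"
        using gt[of j] same_block_trans[OF py U_y yij] 2 by blast
      then have "same_block x a j \<or> same_block x m j"
        using 2(2,3) am(2) lt NC_noncrossing_mod[OF x _ 2(3), of a k]
          NC_noncrossing_mod[OF x _ 2(3), of m k] by linarith
      then show False using 2 by blast
    next
      \<comment> \<open>Here \<open>a\<close> or \<open>m\<close> comes before \<open>i\<close>, and
        the crossing in \<open>x\<close> is formed by that element, \<open>i\<close>,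
        \<open>j\<close> and \<open>k\<close>.\<close>
      case 3
      have "same_block y a i"
        by (rule same_block_trans[OF py U_y[OF 3(1)] same_block_sym[OF yij]])
      then have "m mod n < i mod n" using gt 3(4) by blast
      then have "same_block x a i \<or> same_block x m i"
        using 3(1,3) am(2) lt NC_noncrossing_mod[OF x _ 3(3), of a j]
          NC_noncrossing_mod[OF x _ 3(3), of m j] by linarith
      then show False using 3 by blast
    qed
  qed
  then show "same_block (merge x a m) i j" unfolding sb by blast
qed

section \<open>Cover relations of noncrossing partitions\<close>

definition NC_cover :: "nat \<Rightarrow> nat set set \<Rightarrow> nat set set \<Rightarrow> bool" where
  "NC_cover n x y \<longleftrightarrow> x \<in> NC n \<and> y \<in> NC n \<and> x \<noteq> y \<and> dref x y \<and>
     (\<forall>z\<in>NC n. dref x z \<and> dref z y \<longrightarrow> z = x \<or> z = y)"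

lemma dref_merge:
  assumes "x \<in> NC n" "a \<in> {1..n}"
  shows "dref x (merge x a m)"
  using dref_iff_same_block[OF NC_partition[OF assms(1)] partition_on_merge[OF NC_partition[OF assms(1)] assms(2)]]
    same_block_merge[OF NC_partition[OF assms(1)]] by metis

lemma merge_dref:
  assumes x: "x \<in> NC n" and y: "y \<in> NC n" and "dref x y" "same_block y a m"
  shows "dref (merge x a m) y"
proof -
  note px = NC_partition[OF x] and py = NC_partition[OF y]
  have a: "a \<in> {1..n}" using same_block_in[OF py assms(4)] by blast
  have U: "same_block y a i" if "same_block x a i \<or> same_block x m i" for i
    using that dref_same_block[OF assms(3)] same_block_trans[OF py assms(4)] by blast
  have "same_block y i j" if "same_block (merge x a m) i j" for i j
    using that dref_same_block[OF assms(3), of i j]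
      same_block_trans[OF py same_block_sym[OF U[of i]] U[of j]]
    unfolding same_block_merge[OF px] by blast
  then show ?thesis using dref_iff_same_block[OF partition_on_merge[OF px a] py] by blast
qed

lemma nonmin_psubset:
  assumes "x \<in> NC n" "y \<in> NC n" "dref x y" "x \<noteq> y"
  shows "nonmin n x \<subset> nonmin n y"
  using nonmin_mono[OF assms(3), of n] nonmin_inj[OF assms(1-3)] assms(4) by blast

text \<open>The greedy step: \<open>m\<close> is the least block minimum that is lost on the way to
  \<open>y\<close>, and \<open>a\<close> is the minimum of its block in \<open>y\<close>.\<close>

lemma first_merge:
  assumes x: "x \<in> NC n" and y: "y \<in> NC n" and xy: "dref x y" "x \<noteq> y"
  obtains a m where "same_block y a m" "a mod n < m mod n" "a mod n \<notin> nonmin n y"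
    "m mod n \<in> nonmin n y - nonmin n x" "m mod n = Min (nonmin n y - nonmin n x)"
    "NC_cover n x (merge x a m)" "dref (merge x a m) y"
    "nonmin n (merge x a m) = insert (m mod n) (nonmin n x)"
proof -
  let ?D = "nonmin n y - nonmin n x"
  have fin: "finite ?D" using finite_nonmin[OF y] by blast
  have "?D \<noteq> {}" using nonmin_psubset[OF x y xy] by blast
  then have Min: "Min ?D \<in> ?D" using fin Min_in by blast
  have "\<exists>m j. r = m mod n \<and> same_block y j m" if "r \<in> nonmin n y" for r
    using that unfolding nonmin_def by blast
  then obtain m j where m: "Min ?D = m mod n" "same_block y j m" using Min by blast
  have m_in: "m \<in> {1..n}" using same_block_in[OF NC_partition[OF y] m(2)] by blast
  then obtain a where a: "same_block y a m" "a mod n \<notin> nonmin n y" "a mod n \<le> m mod n"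
    using block_min[OF y m_in] same_block_refl[OF NC_partition[OF y] m_in] by metis
  have mD: "m mod n \<in> ?D" using Min m(1) by simp
  then have lt: "a mod n < m mod n" using a(2,3) by (metis DiffD1 le_less)
  have a_in: "a \<in> {1..n}" using same_block_in[OF NC_partition[OF y] a(1)] by blast
  have ax: "a mod n \<notin> nonmin n x" using a(2) nonmin_mono[OF xy(1)] by blast
  have least: "m mod n \<le> l" if "l \<in> ?D" for l using that fin m(1) by (metis Min_le)
  let ?z = "merge x a m"
  have z: "?z \<in> NC n"
    by (rule merge_in_NC[OF x y xy(1) a(1) lt a(2) _ least]) (use mD in auto)
  have nz: "nonmin n ?z = insert (m mod n) (nonmin n x)"
    using nonmin_merge[OF x a_in m_in lt ax] mD by blast
  have "NC_cover n x ?z"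
    unfolding NC_cover_def
  proof (intro conjI ballI impI x z dref_merge[OF x a_in])
    show "x \<noteq> ?z" using nz mD by auto
    fix w assume w: "w \<in> NC n" "dref x w \<and> dref w ?z"
    then have "nonmin n x \<subseteq> nonmin n w" "nonmin n w \<subseteq> insert (m mod n) (nonmin n x)"
      using nonmin_mono[of x w n] nonmin_mono[of w ?z n] nz by auto
    \<comment> \<open>Only one element separates the two bounds, and \<open>nonmin_inj\<close> turns
      equal minima into equal partitions.\<close>
    then have "nonmin n w = nonmin n x \<or> nonmin n w = nonmin n ?z" unfolding nz by blast
    then show "w = x \<or> w = ?z"
      using nonmin_inj[OF x w(1)] nonmin_inj[OF w(1) z] w(2) by metis
  qed
  then show ?thesis
    using that[OF a(1) lt a(2) mD m(1)[symmetric] _ merge_dref[OF x y xy(1) a(1)] nz] by blast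
qed

text \<open>In \<open>z\<close> the block of \<open>m\<close> has a smaller minimum
  \<open>b\<close>. By leastness of \<open>m\<close>, \<open>b\<close> is not lost later either, so
  it is the minimum \<open>a\<close> of the \<open>y\<close>-block. Hence \<open>z\<close> lies
  above \<open>merge x a m\<close>, and as a cover of \<open>x\<close> it equals it.\<close>

lemma first_merge_unique:
  assumes z: "NC_cover n x z" and y: "y \<in> NC n" and zy: "dref z y"
    and am: "same_block y a m" "a mod n \<notin> nonmin n y"
    and least: "m mod n = Min (nonmin n y - nonmin n x)"
    and nz: "nonmin n z = insert (m mod n) (nonmin n x)"
    and merge: "NC_cover n x (merge x a m)"
  shows "z = merge x a m"
proof -
  have zN: "z \<in> NC n" and xz: "dref x z" using z by (auto simp: NC_cover_def)
  note pz = NC_partition[OF zN] and py = NC_partition[OF y]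
  have mem: "m \<in> {1..n}" "a \<in> {1..n}" using same_block_in[OF py am(1)] by auto
  obtain b where b: "same_block z b m" "b mod n \<notin> nonmin n z" "b mod n \<le> m mod n"
    using block_min[OF zN mem(1)] same_block_refl[OF pz mem(1)] by metis
  have "b mod n \<noteq> m mod n" using b(2) nz by auto
  then have lt: "b mod n < m mod n" using b(3) by linarith
  have "b mod n \<notin> nonmin n y"
  proof
    assume "b mod n \<in> nonmin n y"
    then have "b mod n \<in> nonmin n y - nonmin n x" using b(2) nz by auto
    then have "m mod n \<le> b mod n" using finite_nonmin[OF y] least by simp
    then show False using lt by linarith
  qed
  moreover have "same_block y a b"
    by (rule same_block_trans[OF py am(1) same_block_sym[OF dref_same_block[OF zy b(1)]]])
  ultimately have "a = b" using not_nonmin_unique[OF y _ am(2)] by blast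
  then have "dref (merge x a m) z"
    using merge_dref[OF _ zN xz] b(1) z by (auto simp: NC_cover_def)
  then show ?thesis using z merge unfolding NC_cover_def by metis
qed

text \<open>The greedy step is applied to the two-element interval itself: its result lies above
  \<open>x\<close> and below \<open>y\<close> and differs from \<open>x\<close>, so it is
  \<open>y\<close>.\<close>

lemma NC_cover_merge:
  assumes "NC_cover n x y"
  obtains a m where "y = merge x a m" "a \<in> {1..n}" "m \<in> {1..n}" "\<not> same_block x a m"
    "m mod n \<notin> nonmin n x" "nonmin n y = insert (m mod n) (nonmin n x)"
proof -
  have N: "x \<in> NC n" "y \<in> NC n" "dref x y" "x \<noteq> y" using assms by (auto simp: NC_cover_def)
  obtain a m where am: "same_block y a m" "a mod n < m mod n" "a mod n \<notin> nonmin n y"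
    "m mod n \<in> nonmin n y - nonmin n x" "NC_cover n x (merge x a m)" "dref (merge x a m) y"
    "nonmin n (merge x a m) = insert (m mod n) (nonmin n x)"
    using first_merge[OF N] by metis
  have y: "y = merge x a m" using assms am(5,6) unfolding NC_cover_def by metis
  have "a mod n \<notin> nonmin n x" using am(3,7) y by auto
  then have "\<not> same_block x a m" using not_nonmin_unique[OF N(1), of a m] am(2,4) by auto
  then show ?thesis
    using that[OF y] same_block_in[OF NC_partition[OF N(2)] am(1)] am(4,7) y by blast
qed

lemma dref_imp_NC_covers:
  assumes y: "y \<in> NC n"
  shows "x \<in> NC n \<Longrightarrow> dref x y \<Longrightarrow> (NC_cover n)\<^sup>*\<^sup>* x y"
proof (induction "card (nonmin n y - nonmin n x)" arbitrary: x rule: less_induct)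
  case less
  show ?case
  proof (cases "x = y")
    case False
    then obtain a m where am: "m mod n \<in> nonmin n y - nonmin n x"
      "NC_cover n x (merge x a m)" "dref (merge x a m) y"
      "nonmin n (merge x a m) = insert (m mod n) (nonmin n x)"
      using first_merge[OF less.prems(1) y less.prems(2)] by metis
    have "card (nonmin n y - nonmin n (merge x a m)) < card (nonmin n y - nonmin n x)"
      using am finite_nonmin[OF y] by (intro psubset_card_mono) auto
    then have "(NC_cover n)\<^sup>*\<^sup>* (merge x a m) y"
      using less.hyps am(2,3) by (auto simp: NC_cover_def)
    then show ?thesis using am(2) by (rule converse_rtranclp_into_rtranclp[rotated])
  qed simp
qed

lemma NC_covers_imp_dref: "(NC_cover n)\<^sup>*\<^sup>* x y \<Longrightarrow> dref x y"
proof (induction rule: rtranclp_induct)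
  case (step y z)
  then show ?case using dref_trans[of x y z] by (simp add: NC_cover_def)
qed (rule dref_refl)

lemma graded_edges_NC: "graded_edges (NC n) (NC_cover n) dref (nonmin n)"
proof
  fix x y :: "nat set set"
  show "x \<in> NC n \<and> y \<in> NC n" if "NC_cover n x y" using that by (simp add: NC_cover_def)
  show "dref x y \<longleftrightarrow> (NC_cover n)\<^sup>*\<^sup>* x y" if "x \<in> NC n" "y \<in> NC n"
    using dref_imp_NC_covers[OF that(2,1)] NC_covers_imp_dref by blast
  show "finite (nonmin n x)" if "x \<in> NC n" using finite_nonmin[OF that] .
  show "\<exists>l. l \<notin> nonmin n x \<and> nonmin n y = insert l (nonmin n x)" if "NC_cover n x y"
    using NC_cover_merge[OF that] by metis
qed

section \<open>Edges without the forbidden label\<close>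

text \<open>All of \<open>B2\<close> is at least the label and disjoint from \<open>B1\<close>, so
  the label \<open>n - 1\<close> leaves only \<open>B2 = {n}\<close>. Conversely, a block
  \<open>{n}\<close> that gets merged must be \<open>B2\<close>, and then \<open>n - 1\<close> is
  the largest element of \<open>B1\<close>. Later arguments about the value of the parking label
  rely on this criterion alone.\<close>

lemma parking_label_eq_pred_iff:
  assumes xy: "NC_cover n x y" and n: "n \<ge> 2"
  shows "parking_label x y = n - 1 \<longleftrightarrow> {n} \<in> x \<and> same_block y (n - 1) n"
proof -
  have x: "x \<in> NC n" using xy by (simp add: NC_cover_def)
  note p = NC_partition[OF x]
  obtain a m where y: "y = merge x a m" and mem: "a \<in> {1..n}" "m \<in> {1..n}"
    and nam: "\<not> same_block x a m"
    using NC_cover_merge[OF xy] by metis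
  obtain X Y where X: "X \<in> x" "a \<in> X" and Y: "Y \<in> x" "m \<in> Y"
    using mem same_block_refl[OF p] unfolding same_block_def by blast
  have fin: "finite B" "B \<subseteq> {1..n}" "B \<noteq> {}" if "B \<in> x" for B
  proof -
    show "B \<subseteq> {1..n}" using p that by (auto simp: partition_on_def)
    then show "finite B" using finite_subset by blast
    show "B \<noteq> {}" using block_nonempty[OF p that] by blast
  qed
  have "\<Union>{B \<in> x. a \<in> B \<or> m \<in> B} = X \<union> Y"
    using X Y block_unique[OF p X(1) _ X(2)] block_unique[OF p Y(1) _ Y(2)] by blast
  then have y': "y = {B \<in> x. a \<notin> B \<and> m \<notin> B} \<union> {X \<union> Y}" unfolding y merge_def by simp
  have "X \<noteq> Y" using nam X Y by (auto simp: same_block_def)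
  have "Min X \<noteq> Min Y"
    using block_unique[OF p X(1) Y(1)] \<open>X \<noteq> Y\<close> fin[OF X(1)] fin[OF Y(1)] by (metis Min_in)
  then obtain B1 B2 where B: "{B1, B2} = {X, Y}" "Min B1 < Min B2"
    by (metis insert_commute linorder_neqE_nat)
  have Bx: "B1 \<in> x" "B2 \<in> x" and U: "X \<union> Y = B1 \<union> B2" using B(1) X Y by (auto simp: doubleton_eq_iff)
  have By: "B1 \<union> B2 \<in> y" using y' U by simp
  have new: "D = B1 \<union> B2" if "D \<in> y" "D \<notin> x" for D using that y' U by auto
  \<comment> \<open>Uniqueness of the merged pair, needed to evaluate the definite description in
    \<open>parking_label\<close>.\<close>
  have pair: "C1 = B1 \<and> C2 = B2" if C: "C1 \<in> x" "C2 \<in> x" "C1 \<union> C2 \<in> y" "Min C1 < Min C2" for C1 C2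
  proof -
    obtain i j where i: "i \<in> C1" and j: "j \<in> C2" using block_nonempty[OF p] C by metis
    have "C1 \<union> C2 \<notin> x"
    proof
      assume "C1 \<union> C2 \<in> x"
      then have "C1 \<union> C2 = C1" "C1 \<union> C2 = C2"
        using block_unique[OF p _ C(1), of _ i] block_unique[OF p _ C(2), of _ j] i j by blast+
      then show False using C(4) by simp
    qed
    then have eq: "C1 \<union> C2 = B1 \<union> B2" using new C(3) by blast
    have c1: "C1 = B1 \<or> C1 = B2"
      using eq i block_unique[OF p C(1) Bx(1)] block_unique[OF p C(1) Bx(2)] by blast
    have c2: "C2 = B1 \<or> C2 = B2"
      using eq j block_unique[OF p C(2) Bx(1)] block_unique[OF p C(2) Bx(2)] by blast
    show ?thesis using c1 c2 C(4) B(2) by (metis less_asym less_irrefl)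
  qed
  let ?S = "{j \<in> B1. \<forall>i\<in>B2. j \<le> i}"
  have lab: "parking_label x y = Max ?S"
    unfolding parking_label_def
  proof (rule the_equality)
    show "\<exists>C1\<in>x. \<exists>C2\<in>x. C1 \<union> C2 \<in> y \<and> Min C1 < Min C2 \<and>
        Max ?S = Max {j \<in> C1. \<forall>i\<in>C2. j \<le> i}"
      using Bx By B(2) by blast
    show "k = Max ?S" if "\<exists>C1\<in>x. \<exists>C2\<in>x. C1 \<union> C2 \<in> y \<and> Min C1 < Min C2 \<and>
        k = Max {j \<in> C1. \<forall>i\<in>C2. j \<le> i}" for k
      using that pair by metis
  qed
  note f1 = fin[OF Bx(1)] and f2 = fin[OF Bx(2)]
  have disj: "i \<notin> B2" if "i \<in> B1" for i
    using block_unique[OF p Bx that] B(2) by auto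
  have "Min B1 \<in> ?S" using Min_in[OF f1(1,3)] Min_le[OF f2(1)] B(2) by fastforce
  then have S: "finite ?S" "?S \<noteq> {}" using f1(1) by (simp, blast)
  show ?thesis
  proof
    assume "parking_label x y = n - 1"
    then have "n - 1 \<in> ?S" using lab Max_in[OF S] by simp
    then have n1: "n - 1 \<in> B1" "\<forall>i\<in>B2. n - 1 \<le> i" by auto
    have "i = n" if "i \<in> B2" for i
    proof -
      have "n - 1 \<le> i" "i \<noteq> n - 1" "i \<le> n" using n1 that disj[OF n1(1)] f2(2) by auto
      then show ?thesis by linarith
    qed
    then have B2: "B2 = {n}" using f2(3) by blast
    then have "same_block y (n - 1) n" using By n1(1) unfolding same_block_def by blast
    then show "{n} \<in> x \<and> same_block y (n - 1) n" using B2 Bx by simp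
  next
    assume r: "{n} \<in> x \<and> same_block y (n - 1) n"
    then obtain D where D: "D \<in> y" "n - 1 \<in> D" "n \<in> D" by (auto simp: same_block_def)
    have "D \<notin> x"
    proof
      assume "D \<in> x"
      then have "D = {n}" using block_unique[OF p, of D "{n}" n] D r by blast
      then show False using D n by auto
    qed
    then have D': "D = B1 \<union> B2" using new D by blast
    have "n \<notin> B1"
    proof
      assume "n \<in> B1"
      then have "B1 = {n}" using block_unique[OF p Bx(1), of "{n}" n] r by blast
      then show False using B(2) Min_in[OF f2(1,3)] f2(2) by force
    qed
    then have "n \<in> B2" using D D' by blast
    then have B2: "B2 = {n}" using block_unique[OF p Bx(2), of "{n}" n] r by blast
    then have "n - 1 \<in> B1" using D D' n by auto
    moreover have "j \<le> n - 1" if "j \<in> B1" for j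
    proof -
      have "j \<le> n" "j \<noteq> n" using that f1(2) \<open>n \<notin> B1\<close> by auto
      then show ?thesis by linarith
    qed
    ultimately have "Max ?S = n - 1" using B2 f1(1) by (intro Max_eqI) auto
    then show "parking_label x y = n - 1" using lab by simp
  qed
qed

section \<open>Reachability along edges without the label \<open>n - 1\<close>\<close>

definition good_edge :: "nat \<Rightarrow> nat set set \<Rightarrow> nat set set \<Rightarrow> bool" where
  "good_edge n x y \<longleftrightarrow> NC_cover n x y \<and> parking_label x y \<noteq> n - 1"

text \<open>If \<open>{n}\<close> is a block of \<open>x\<close> and the least element of the block of \<open>n\<close> in \<open>y\<close> lies in the
  \<open>x\<close>-block of \<open>n - 1\<close>, then noncrossingness forces \<open>n\<close> to be merged with \<open>n - 1\<close> on any chain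
  from \<open>x\<close> to \<open>y\<close>. This is the only obstruction to a chain avoiding the label \<open>n - 1\<close>.\<close>

definition unblocked :: "nat \<Rightarrow> nat set set \<Rightarrow> nat set set \<Rightarrow> bool" where
  "unblocked n x y \<longleftrightarrow> \<not> ({n} \<in> x \<and>
     (\<exists>p. same_block x p (n - 1) \<and> same_block y p n \<and> (\<forall>q<p. \<not> same_block y q n)))"

text \<open>Let \<open>p\<close> block \<open>x\<close>. A good edge does not join \<open>n\<close>
  to the block of \<open>n - 1\<close>. Nor can it join \<open>n\<close> to some other
  \<open>q\<close>: minimality of \<open>p\<close> gives \<open>p < q < n - 1 < n\<close>, and the
  pairs \<open>p\<close>, \<open>n - 1\<close> and \<open>q\<close>, \<open>n\<close> would cross.
  So \<open>{n}\<close> survives in \<open>z\<close> and the same \<open>p\<close> blocks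
  \<open>z\<close>.\<close>

lemma unblocked_good_edge:
  assumes g: "good_edge n x z" and y: "y \<in> NC n" and zy: "dref z y" and u: "unblocked n z y" and n: "n \<ge> 2"
  shows "unblocked n x y"
  unfolding unblocked_def
proof
  have c: "NC_cover n x z" and x: "x \<in> NC n" and z: "z \<in> NC n" and xz: "dref x z"
    using g by (auto simp: good_edge_def NC_cover_def)
  note px = NC_partition[OF x] and py = NC_partition[OF y] and pz = NC_partition[OF z]
  assume "{n} \<in> x \<and> (\<exists>p. same_block x p (n - 1) \<and> same_block y p n \<and> (\<forall>q<p. \<not> same_block y q n))"
  then obtain p where nx: "{n} \<in> x" and p: "same_block x p (n - 1)" "same_block y p n"
    "\<And>q. same_block y q n \<Longrightarrow> p \<le> q" by (auto simp: not_less[symmetric])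
  have bad: "\<not> same_block z (n - 1) n"
    using g parking_label_eq_pred_iff[OF c n] nx by (auto simp: good_edge_def)
  have pz1: "same_block z p (n - 1)" using dref_same_block[OF xz p(1)] .
  have "{n} \<in> z"
    unfolding singleton_block_iff[OF pz]
  proof (intro conjI allI impI)
    show "n \<in> {1..n}" using n by auto
    fix q assume nq: "same_block z n q"
    show "q = n"
    proof (rule ccontr)
      assume "q \<noteq> n"
      have qn: "same_block z q n" using nq by (rule same_block_sym)
      have "p \<le> q" using p(3)[OF dref_same_block[OF zy qn]] .
      moreover have "q \<noteq> p"
        using bad same_block_trans[OF pz same_block_sym[OF pz1]] qn by auto
      moreover have "q \<noteq> n - 1" using bad qn by auto
      moreover have "q \<le> n" "1 \<le> p" using same_block_in[OF pz qn] same_block_in[OF pz pz1] by auto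
      ultimately have lt: "1 \<le> p" "p < q" "q < n - 1" "n - 1 < n" using \<open>q \<noteq> n\<close> by auto
      then have "same_block z p q"
        using z pz1 qn unfolding NC_def by blast
      then have "same_block z p n" using same_block_trans[OF pz _ qn] by blast
      then show False using bad same_block_trans[OF pz same_block_sym[OF pz1]] by blast
    qed
  qed
  then show False using u pz1 p(2,3) unfolding unblocked_def by (meson not_less)
qed

text \<open>With the converse \<open>unblocked_good_edges\<close>, reachability by good edges
  becomes \<open>dref\<close> together with \<open>unblocked\<close>.\<close>

lemma good_edges_unblocked:
  assumes "y \<in> NC n" "n \<ge> 2"
  shows "(good_edge n)\<^sup>*\<^sup>* x y \<Longrightarrow> x \<in> NC n \<and> dref x y \<and> unblocked n x y"
proof (induction rule: converse_rtranclp_induct)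
  case base
  have "unblocked n y y"
    unfolding unblocked_def
  proof
    assume a: "{n} \<in> y \<and> (\<exists>p. same_block y p (n - 1) \<and> same_block y p n \<and> (\<forall>q<p. \<not> same_block y q n))"
    then obtain p where p: "same_block y p (n - 1)" "same_block y p n" by blast
    have "same_block y n (n - 1)"
      by (rule same_block_trans[OF NC_partition[OF assms(1)] same_block_sym[OF p(2)] p(1)])
    then have "n - 1 = n" using a singleton_block_iff[OF NC_partition[OF assms(1)]] by blast
    then show False using assms(2) by simp
  qed
  then show ?case using assms dref_refl by blast
next
  case (step x z)
  then have "x \<in> NC n" "dref x z" by (auto simp: good_edge_def NC_cover_def)
  then show ?case
    using step dref_trans[of x z y] unblocked_good_edge[OF step(1) assms(1) _ _ assms(2)] by blast
qed

text \<open>If the greedy step joined \<open>{n}\<close> to the block of \<open>n - 1\<close>, then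
  \<open>a = n\<close> and \<open>m\<close> would lie in that block; leastness of \<open>m\<close>
  would make it an element that blocks \<open>x\<close>. If the step created a new obstruction, the
  merged block would lie in the \<open>y\<close>-block of \<open>n\<close>, forcing
  \<open>a = n\<close>, although \<open>{n}\<close> is supposed to remain a block.\<close>

lemma first_merge_good:
  assumes x: "x \<in> NC n" and y: "y \<in> NC n" and xy: "dref x y" and u: "unblocked n x y" and n: "n \<ge> 2"
    and am: "same_block y a m" "a mod n < m mod n" "a mod n \<notin> nonmin n y"
      "m mod n \<in> nonmin n y - nonmin n x" "m mod n = Min (nonmin n y - nonmin n x)"
    and z: "NC_cover n x (merge x a m)" "dref (merge x a m) y"
  shows "good_edge n x (merge x a m) \<and> unblocked n (merge x a m) y"
proof -
  let ?z = "merge x a m"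
  note px = NC_partition[OF x] and py = NC_partition[OF y]
  note sb = same_block_merge[OF px, of a m]
  have zN: "?z \<in> NC n" and xz: "dref x ?z" using z by (auto simp: NC_cover_def)
  note pz = NC_partition[OF zN]
  have mem: "a \<in> {1..n}" "m \<in> {1..n}" using same_block_in[OF py am(1)] by auto
  have mn: "m \<noteq> n" using am(2) by auto
  have n_in: "n \<in> {1..n}" using n by auto
  have not_bad: "\<not> ({n} \<in> x \<and> same_block ?z (n - 1) n)"
  proof
    assume r: "{n} \<in> x \<and> same_block ?z (n - 1) n"
    have iso: "j = n" if "same_block x j n" for j
      using r singleton_block_iff[OF px] same_block_sym[OF that] by blast
    have far: "\<not> same_block x (n - 1) n" using iso[of "n - 1"] n by auto
    then have r': "same_block x a (n - 1) \<or> same_block x m (n - 1)"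
      "same_block x a n \<or> same_block x m n"
      using r unfolding sb by auto
    then have an: "a = n" using iso mn by blast
    then have m1: "same_block x m (n - 1)" using r'(1) far same_block_sym[of x n "n - 1"] by blast
    have mny: "same_block y m n" using same_block_sym[OF am(1)] an by simp
    \<comment> \<open>Below \<open>n\<close> the rotated and the usual order agree. The minimum of
      the \<open>x\<close>-block of \<open>q\<close> differs from \<open>n\<close>, hence is lost in
      \<open>y\<close>, and it is less than \<open>m\<close>.\<close>
    have "\<not> same_block y q n" if q: "q < m" for q
    proof
      assume qn: "same_block y q n"
      have q_in: "q \<in> {1..n}" using same_block_in[OF py qn] by blast
      have "q < n" "m < n" using q mem mn by auto
      then have mods: "q mod n = q" "m mod n = m" by auto
      obtain b where b: "same_block x b q" "b mod n \<notin> nonmin n x" "b mod n \<le> q mod n"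
        using block_min[OF x q_in] same_block_refl[OF px q_in] by metis
      have "b \<noteq> n" using r singleton_block_iff[OF px] b(1) \<open>q < n\<close> by blast
      have yb: "same_block y a b"
        using same_block_trans[OF py _ dref_same_block[OF xy same_block_sym[OF b(1)]]]
          same_block_sym[OF qn] an by blast
      then have "b mod n \<in> nonmin n y"
        using not_nonmin_unique[OF y yb am(3)] an \<open>b \<noteq> n\<close> by blast
      then have "b mod n \<in> nonmin n y - nonmin n x" using b(2) by blast
      then have "m mod n \<le> b mod n" using am(5) finite_nonmin[OF y] by simp
      then show False using b(3) q mods by linarith
    qed
    then show False using u r m1 mny unfolding unblocked_def by blast
  qed
  have "unblocked n ?z y"
    unfolding unblocked_def
  proof
    assume "{n} \<in> ?z \<and> (\<exists>p. same_block ?z p (n - 1) \<and> same_block y p n \<and> (\<forall>q<p. \<not> same_block y q n))"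
    then obtain p where nz: "{n} \<in> ?z" and p: "same_block ?z p (n - 1)" "same_block y p n"
      "\<And>q. q < p \<Longrightarrow> \<not> same_block y q n" by blast
    have iso: "j = n" if "same_block ?z n j" for j
      using nz that singleton_block_iff[OF pz] by blast
    have "{n} \<in> x"
      using iso dref_same_block[OF xz] n_in unfolding singleton_block_iff[OF px] by blast
    then have "\<not> same_block x p (n - 1)" using u p(2,3) unfolding unblocked_def by blast
    then have "same_block x a p \<or> same_block x m p" using p(1) unfolding sb by blast
    then have "same_block y a p"
      using dref_same_block[OF xy] same_block_trans[OF py am(1)] by blast
    then have an: "same_block y a n" using same_block_trans[OF py _ p(2)] by blast
    \<comment> \<open>No residue is below \<open>n mod n = 0\<close>, so \<open>n\<close> is always
      the minimum of its block.\<close>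
    have "n mod n \<notin> nonmin n y" by (auto simp: nonmin_def)
    then have "a = n" using not_nonmin_unique[OF y an am(3)] by blast
    moreover have "same_block ?z a m" unfolding sb using same_block_refl[OF px] mem by blast
    ultimately show False using iso[of m] mn by blast
  qed
  moreover have "good_edge n x ?z"
    using z(1) parking_label_eq_pred_iff[OF z(1) n] not_bad unfolding good_edge_def by blast
  ultimately show ?thesis by blast
qed

text \<open>The greedy chain works: its first edge is good and preserves \<open>unblocked\<close>,
  while the set of minima still to be lost shrinks.\<close>

lemma unblocked_good_edges:
  assumes y: "y \<in> NC n" and n: "n \<ge> 2"
  shows "x \<in> NC n \<Longrightarrow> dref x y \<Longrightarrow> unblocked n x y \<Longrightarrow> (good_edge n)\<^sup>*\<^sup>* x y"
proof (induction "card (nonmin n y - nonmin n x)" arbitrary: x rule: less_induct)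
  case less
  show ?case
  proof (cases "x = y")
    case False
    then obtain a m where am: "same_block y a m" "a mod n < m mod n" "a mod n \<notin> nonmin n y"
      "m mod n \<in> nonmin n y - nonmin n x" "m mod n = Min (nonmin n y - nonmin n x)"
      and z: "NC_cover n x (merge x a m)" "dref (merge x a m) y"
      and nz: "nonmin n (merge x a m) = insert (m mod n) (nonmin n x)"
      using first_merge[OF less.prems(1) y less.prems(2)] by metis
    note good = first_merge_good[OF less.prems(1) y less.prems(2,3) n am z]
    have "card (nonmin n y - nonmin n (merge x a m)) < card (nonmin n y - nonmin n x)"
      using am(4) nz finite_nonmin[OF y] by (intro psubset_card_mono) auto
    then have "(good_edge n)\<^sup>*\<^sup>* (merge x a m) y"
      using less.hyps z good by (auto simp: NC_cover_def)
    then show ?thesis using good by (meson converse_rtranclp_into_rtranclp)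
  qed simp
qed

section \<open>The poset of chains avoiding the forbidden label\<close>

definition NC_bot :: "nat \<Rightarrow> nat set set" where
  "NC_bot n = (\<lambda>i. {i}) ` {1..n}"

definition NC_top :: "nat \<Rightarrow> nat set set" where
  "NC_top n = {{1..n}}"

lemma same_block_NC_bot: "same_block (NC_bot n) i j \<longleftrightarrow> i = j \<and> i \<in> {1..n}"
  by (auto simp: same_block_def NC_bot_def)

lemma same_block_NC_top: "same_block (NC_top n) i j \<longleftrightarrow> i \<in> {1..n} \<and> j \<in> {1..n}"
  by (auto simp: same_block_def NC_top_def)

lemma NC_bot_in_NC: "NC_bot n \<in> NC n"
proof -
  have "partition_on {1..n} (NC_bot n)"
    by (auto simp: partition_on_def NC_bot_def disjoint_def)
  then show ?thesis by (auto simp: NC_def same_block_NC_bot)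
qed

lemma NC_top_in_NC: "n \<ge> 1 \<Longrightarrow> NC_top n \<in> NC n"
proof -
  assume "n \<ge> 1"
  then have "partition_on {1..n} (NC_top n)"
    by (auto simp: partition_on_def NC_top_def)
  then show ?thesis by (auto simp: NC_def same_block_NC_top)
qed

lemma NC_bot_dref: "x \<in> NC n \<Longrightarrow> dref (NC_bot n) x"
  using dref_iff_same_block[OF NC_partition[OF NC_bot_in_NC] NC_partition[of x n]]
    same_block_refl[OF NC_partition[of x n]] unfolding same_block_NC_bot by blast

lemma dref_NC_top:
  assumes "x \<in> NC n"
  shows "dref x (NC_top n)"
proof -
  have "B \<subseteq> {1..n}" if "B \<in> x" for B
    using NC_partition[OF assms] that by (auto simp: partition_on_def)
  then show ?thesis by (simp add: dref_def NC_top_def)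
qed

lemma finite_NC: "finite (NC n)"
proof (rule finite_subset)
  show "NC n \<subseteq> Pow (Pow {1..n})"
    using NC_partition partition_onD1 by blast
qed simp

text \<open>Starting from singletons, the only candidate for the blocking element is
  \<open>n - 1\<close> itself, and it is least in the block of \<open>n\<close> exactly when that
  block is \<open>{n - 1, n}\<close>. Dually, below the one-block partition the only candidate is
  \<open>1\<close>. These are the two conditions in the definition of \<open>PE\<close>.\<close>

lemma unblocked_NC_bot_iff:
  assumes x: "x \<in> NC n" and n: "n \<ge> 2"
  shows "unblocked n (NC_bot n) x \<longleftrightarrow> {n - 1, n} \<notin> x"
proof -
  note p = NC_partition[OF x]
  have "{n} \<in> NC_bot n" using n by (auto simp: NC_bot_def)
  moreover have "n - 1 \<in> {1..n}" using n by auto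
  ultimately have "unblocked n (NC_bot n) x \<longleftrightarrow>
      \<not> (same_block x (n - 1) n \<and> (\<forall>q<n - 1. \<not> same_block x q n))"
    unfolding unblocked_def same_block_NC_bot by metis
  also have "same_block x (n - 1) n \<and> (\<forall>q<n - 1. \<not> same_block x q n) \<longleftrightarrow> {n - 1, n} \<in> x"
  proof
    assume r: "same_block x (n - 1) n \<and> (\<forall>q<n - 1. \<not> same_block x q n)"
    then obtain B where B: "B \<in> x" "n - 1 \<in> B" "n \<in> B" by (auto simp: same_block_def)
    have "q = n - 1 \<or> q = n" if "q \<in> B" for q
    proof -
      have "same_block x q n" using that B by (auto simp: same_block_def)
      then have "\<not> q < n - 1" "q \<le> n" using r same_block_in[OF p] by auto
      then show ?thesis by linarith
    qed
    then have "B = {n - 1, n}" using B by blast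
    then show "{n - 1, n} \<in> x" using B by simp
  next
    assume B: "{n - 1, n} \<in> x"
    have "same_block x n q \<longleftrightarrow> q = n - 1 \<or> q = n" for q
      using same_block_iff[OF p B, of n q] by simp
    then show "same_block x (n - 1) n \<and> (\<forall>q<n - 1. \<not> same_block x q n)"
      using same_block_sym[of x] by (metis diff_le_self less_irrefl not_less)
  qed
  finally show ?thesis by blast
qed

lemma unblocked_NC_top_iff:
  assumes x: "x \<in> NC n" and n: "n \<ge> 2"
  shows "unblocked n x (NC_top n) \<longleftrightarrow> \<not> (same_block x 1 (n - 1) \<and> {n} \<in> x)"
proof -
  have "p = 1 \<longleftrightarrow> p \<in> {1..n} \<and> (\<forall>q<p. q \<notin> {1..n})" for p
  proof
    assume r: "p \<in> {1..n} \<and> (\<forall>q<p. q \<notin> {1..n})"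
    have "1 \<in> {1..n}" using n by simp
    then have "\<not> 1 < p" using r by blast
    then show "p = 1" using r by simp
  qed (use n in auto)
  moreover have "n \<in> {1..n}" using n by auto
  ultimately show ?thesis
    unfolding unblocked_def same_block_NC_top by metis
qed

text \<open>This identifies \<open>PE n\<close> with the union of the parking chains.\<close>

lemma PE_iff_good_edges:
  assumes n: "n \<ge> 2"
  shows "x \<in> PE n \<longleftrightarrow> (good_edge n)\<^sup>*\<^sup>* (NC_bot n) x \<and> (good_edge n)\<^sup>*\<^sup>* x (NC_top n)"
proof -
  have top: "NC_top n \<in> NC n" using NC_top_in_NC n by simp
  have "x \<in> PE n \<longleftrightarrow> x \<in> NC n \<and> unblocked n (NC_bot n) x \<and> unblocked n x (NC_top n)"
    unfolding PE_def using unblocked_NC_bot_iff[OF _ n] unblocked_NC_top_iff[OF _ n] by auto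
  also have "\<dots> \<longleftrightarrow> (good_edge n)\<^sup>*\<^sup>* (NC_bot n) x \<and> (good_edge n)\<^sup>*\<^sup>* x (NC_top n)"
    using unblocked_good_edges[OF _ n NC_bot_in_NC NC_bot_dref]
      unblocked_good_edges[OF top n _ dref_NC_top]
      good_edges_unblocked[OF _ n] top by metis
  finally show ?thesis .
qed

section \<open>Parking chains and the order they generate\<close>

definition PE_edge :: "nat \<Rightarrow> nat set set \<Rightarrow> nat set set \<Rightarrow> bool" where
  "PE_edge n x y \<longleftrightarrow> x \<in> PE n \<and> y \<in> PE n \<and> good_edge n x y"

text \<open>\<open>NC n\<close> is the interval between its bounds, so
  \<open>maximal_chains_interval\<close> for \<open>NC_cover\<close> applies; avoiding the label
  then restricts each step separately.\<close>

lemma parking_chains_eq: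
  assumes "n \<ge> 1"
  shows "parking_chains n =
    {c. c \<noteq> [] \<and> successively (good_edge n) c \<and> hd c = NC_bot n \<and> last c = NC_top n}"
proof -
  interpret graded_edges "NC n" "NC_cover n" dref "nonmin n" by (rule graded_edges_NC)
  have "interval (NC n) dref (NC_bot n) (NC_top n) = NC n"
    using NC_bot_dref dref_NC_top by (auto simp: interval_def)
  moreover have "(NC_cover n)\<^sup>*\<^sup>* (NC_bot n) (NC_top n)"
    using dref_imp_NC_covers NC_top_in_NC[OF assms] NC_bot_in_NC dref_NC_top by blast
  ultimately have chains: "c \<in> maximal_chains (NC n) dref \<longleftrightarrow>
      c \<noteq> [] \<and> successively (NC_cover n) c \<and> hd c = NC_bot n \<and> last c = NC_top n" for c
    using maximal_chains_interval[OF NC_bot_in_NC NC_top_in_NC[OF assms], of c] by simp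
  have lab: "n - 1 \<notin> set (label_seq parking_label c) \<longleftrightarrow>
      (\<forall>e\<in>set (steps c). parking_label (fst e) (snd e) \<noteq> n - 1)" for c
    by (auto simp: label_seq_def image_iff split_beta eq_commute)
  have "successively (good_edge n) c \<longleftrightarrow>
      successively (NC_cover n) c \<and> n - 1 \<notin> set (label_seq parking_label c)" for c
    unfolding successively_iff_steps lab by (simp add: good_edge_def split_beta ball_conj_distrib)
  then show ?thesis unfolding parking_chains_def chains by blast
qed

lemma step_of_parking_chain_iff:
  assumes n: "n \<ge> 2"
  shows "(\<exists>c\<in>parking_chains n. (x, y) \<in> set (steps c)) \<longleftrightarrow> PE_edge n x y"
proof -
  let ?G = "(good_edge n)\<^sup>*\<^sup>*"
  have chains: "c \<in> parking_chains n \<longleftrightarrow>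
      c \<noteq> [] \<and> successively (good_edge n) c \<and> hd c = NC_bot n \<and> last c = NC_top n" for c
    using parking_chains_eq[of n] n by simp
  have "(\<exists>c\<in>parking_chains n. (x, y) \<in> set (steps c)) \<longleftrightarrow>
      ?G (NC_bot n) x \<and> good_edge n x y \<and> ?G y (NC_top n)"
  proof
    assume "\<exists>c\<in>parking_chains n. (x, y) \<in> set (steps c)"
    then obtain c where c: "c \<in> parking_chains n" "(x, y) \<in> set (steps c)" by (rule bexE)
    then show "?G (NC_bot n) x \<and> good_edge n x y \<and> ?G y (NC_top n)"
      using step_on_path[OF c(2), of "good_edge n"] chains[of c] by simp
  next
    assume "?G (NC_bot n) x \<and> good_edge n x y \<and> ?G y (NC_top n)"
    then obtain c where c: "c \<noteq> []" "successively (good_edge n) c" "hd c = NC_bot n"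
        "last c = NC_top n" "(x, y) \<in> set (steps c)"
      using path_through_edge[of "good_edge n" "NC_bot n" x y "NC_top n"] by metis
    then show "\<exists>c\<in>parking_chains n. (x, y) \<in> set (steps c)"
      using chains[of c] by (intro bexI[of _ c]) simp_all
  qed
  also have "\<dots> \<longleftrightarrow> PE_edge n x y"
    unfolding PE_edge_def PE_iff_good_edges[OF n]
    by (meson converse_rtranclp_into_rtranclp rtranclp.rtrancl_into_rtrancl)
  finally show ?thesis .
qed

lemma pchn_eq: "n \<ge> 2 \<Longrightarrow> pchn n = (PE_edge n)\<^sup>*\<^sup>*"
  unfolding pchn_def step_of_parking_chain_iff by simp

text \<open>A good edge may have an end outside \<open>PE n\<close>, such as the edge from
  \<open>{{1}, {2, 3}}\<close> to the top for \<open>n = 3\<close>. On a good path between members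
  of \<open>PE n\<close> this cannot happen: extended to the bottom and the top, it puts every
  vertex into \<open>PE n\<close>.\<close>

lemma PE_edges_iff_good_edges:
  assumes n: "n \<ge> 2" and y: "y \<in> PE n"
  shows "x \<in> PE n \<Longrightarrow> (PE_edge n)\<^sup>*\<^sup>* x y \<longleftrightarrow> (good_edge n)\<^sup>*\<^sup>* x y"
proof
  show "(PE_edge n)\<^sup>*\<^sup>* x y \<Longrightarrow> (good_edge n)\<^sup>*\<^sup>* x y"
    by (erule rtranclp_mono[THEN predicate2D, rotated]) (auto simp: PE_edge_def)
  show "(good_edge n)\<^sup>*\<^sup>* x y \<Longrightarrow> x \<in> PE n \<Longrightarrow> (PE_edge n)\<^sup>*\<^sup>* x y"
  proof (induction rule: converse_rtranclp_induct)
    case (step x z)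
    have "(good_edge n)\<^sup>*\<^sup>* (NC_bot n) z" "(good_edge n)\<^sup>*\<^sup>* z (NC_top n)"
      using step y unfolding PE_iff_good_edges[OF n] by (auto intro: rtranclp_trans)
    then have "z \<in> PE n" unfolding PE_iff_good_edges[OF n] by blast
    moreover from this have "PE_edge n x z" using step by (simp add: PE_edge_def)
    ultimately show ?case using step.IH by (auto intro: converse_rtranclp_into_rtranclp)
  qed simp
qed

lemma graded_edges_PE:
  assumes "n \<ge> 2"
  shows "graded_edges (PE n) (PE_edge n) (pchn n) (nonmin n)"
proof
  fix x y :: "nat set set"
  show "x \<in> PE n \<and> y \<in> PE n" if "PE_edge n x y" using that by (simp add: PE_edge_def)
  show "pchn n x y \<longleftrightarrow> (PE_edge n)\<^sup>*\<^sup>* x y" by (simp add: pchn_eq[OF assms])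
  show "finite (nonmin n x)" if "x \<in> PE n" using that finite_nonmin by (simp add: PE_def)
  show "\<exists>l. l \<notin> nonmin n x \<and> nonmin n y = insert l (nonmin n x)" if "PE_edge n x y"
    using that graded_edges.edge_M[OF graded_edges_NC, of n x y] by (simp add: PE_edge_def good_edge_def)
qed

text \<open>The greedy step and its uniqueness carry over from \<open>NC n\<close>, since the step
  is good and its result reaches \<open>y\<close> by good edges. This supplies the assumption of
  \<open>EL_labeling_new_label\<close>.\<close>

lemma PE_first_edge:
  assumes n: "n \<ge> 2" and x: "x \<in> PE n" and xy: "(PE_edge n)\<^sup>*\<^sup>* x y" "x \<noteq> y"
  obtains z where "PE_edge n x z" "(PE_edge n)\<^sup>*\<^sup>* z y"
    "nonmin n z = insert (Min (nonmin n y - nonmin n x)) (nonmin n x)"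
    "Min (nonmin n y - nonmin n x) \<notin> nonmin n x"
    "\<And>z'. PE_edge n x z' \<Longrightarrow> (PE_edge n)\<^sup>*\<^sup>* z' y \<Longrightarrow> nonmin n z' = nonmin n z \<Longrightarrow> z' = z"
proof -
  have y: "y \<in> PE n" using graded_edges.reachable_in[OF graded_edges_PE[OF n] xy(1) x] .
  have N: "x \<in> NC n" "y \<in> NC n" using x y by (auto simp: PE_def)
  have g: "(good_edge n)\<^sup>*\<^sup>* x y" using PE_edges_iff_good_edges[OF n y x] xy(1) by blast
  have d: "dref x y" "unblocked n x y" using good_edges_unblocked[OF N(2) n g] by auto
  obtain a m where am: "same_block y a m" "a mod n < m mod n" "a mod n \<notin> nonmin n y"
      "m mod n \<in> nonmin n y - nonmin n x" "m mod n = Min (nonmin n y - nonmin n x)"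
    and z: "NC_cover n x (merge x a m)" "dref (merge x a m) y"
    and nz: "nonmin n (merge x a m) = insert (m mod n) (nonmin n x)"
    using first_merge[OF N d(1) xy(2)] by metis
  let ?z = "merge x a m"
  have good: "good_edge n x ?z" "unblocked n ?z y"
    using first_merge_good[OF N d n am z] by auto
  have zN: "?z \<in> NC n" using z(1) by (simp add: NC_cover_def)
  have gz: "(good_edge n)\<^sup>*\<^sup>* ?z y" using unblocked_good_edges[OF N(2) n zN z(2) good(2)] .
  have zP: "?z \<in> PE n"
    using x y gz good(1) unfolding PE_iff_good_edges[OF n] by (auto intro: rtranclp_trans)
  show ?thesis
  proof (rule that)
    show "PE_edge n x ?z" using x zP good(1) by (simp add: PE_edge_def)
    show "(PE_edge n)\<^sup>*\<^sup>* ?z y" using PE_edges_iff_good_edges[OF n y zP] gz by blast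
    show "nonmin n ?z = insert (Min (nonmin n y - nonmin n x)) (nonmin n x)"
      "Min (nonmin n y - nonmin n x) \<notin> nonmin n x" using nz am(4,5) by auto
    fix z' assume z': "PE_edge n x z'" "(PE_edge n)\<^sup>*\<^sup>* z' y" "nonmin n z' = nonmin n ?z"
    have c: "NC_cover n x z'" and P: "z' \<in> PE n" using z'(1) by (auto simp: PE_edge_def good_edge_def)
    have "(good_edge n)\<^sup>*\<^sup>* z' y" using PE_edges_iff_good_edges[OF n y P] z'(2) by blast
    then have "dref z' y" using good_edges_unblocked[OF N(2) n] by blast
    then show "z' = ?z"
      using first_merge_unique[OF c N(2) _ am(1,3,5) _ z(1)] z'(3) nz by simp
  qed
qed

theorem theorem1p1:
  fixes n :: nat
  assumes "n \<ge> 3"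
  shows "EL_shellable (PE n) (pchn n)"
proof -
  have n: "n \<ge> 2" using assms by simp
  interpret graded_edges "PE n" "PE_edge n" "pchn n" "nonmin n" by (rule graded_edges_PE[OF n])
  have top: "NC_top n \<in> NC n" using NC_top_in_NC n by simp
  have bot: "NC_bot n \<in> PE n"
    unfolding PE_def using NC_bot_in_NC assms by (auto simp: same_block_NC_bot) (auto simp: NC_bot_def)
  \<comment> \<open>Here \<open>n \<ge> 3\<close> matters: neither \<open>{n - 1, n}\<close> nor
    \<open>{n}\<close> contains \<open>1\<close>. For \<open>n = 2\<close> the former would be the
    top block.\<close>
  have "B \<notin> NC_top n" if "1 \<notin> B" for B
  proof
    assume "B \<in> NC_top n"
    then have "B = {1..n}" by (simp add: NC_top_def)
    then show False using that n by simp
  qed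
  then have "{n - 1, n} \<notin> NC_top n" "{n} \<notin> NC_top n" using assms by auto
  then have topP: "NC_top n \<in> PE n" using top by (simp add: PE_def)
  have "finite_bounded_poset (PE n) (pchn n)"
    unfolding finite_bounded_poset_def
  proof (intro conjI)
    show "finite (PE n)" using finite_NC by (simp add: PE_def)
    show "reflp_on (PE n) (pchn n)"
      unfolding pchn_eq[OF n] by (rule reflp_onI) (rule rtranclp.rtrancl_refl)
    show "transp_on (PE n) (pchn n)"
      unfolding pchn_eq[OF n] by (rule transp_onI) (rule rtranclp_trans)
    show "antisymp_on (PE n) (pchn n)"
      unfolding pchn_eq[OF n] by (rule antisymp_onI) (rule reachable_antisym)
    have "pchn n (NC_bot n) x \<and> pchn n x (NC_top n)" if x: "x \<in> PE n" for x
      using PE_edges_iff_good_edges[OF n x bot] PE_edges_iff_good_edges[OF n topP x] x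
      unfolding pchn_eq[OF n] PE_iff_good_edges[OF n, of x] by simp
    then show "\<exists>b\<in>PE n. \<forall>x\<in>PE n. pchn n b x" "\<exists>t\<in>PE n. \<forall>x\<in>PE n. pchn n x t"
      using bot topP by (intro bexI; simp)+
  qed
  moreover have "EL_labeling (PE n) (pchn n) new_label (<)"
  proof (rule EL_labeling_new_label)
    fix x y assume xy: "x \<in> PE n" "(PE_edge n)\<^sup>*\<^sup>* x y" "x \<noteq> y"
    let ?m = "Min (nonmin n y - nonmin n x)"
    obtain z where z: "PE_edge n x z" "(PE_edge n)\<^sup>*\<^sup>* z y"
      "nonmin n z = insert ?m (nonmin n x)" "?m \<notin> nonmin n x"
      and uniq: "\<And>z'. PE_edge n x z' \<Longrightarrow> (PE_edge n)\<^sup>*\<^sup>* z' y \<Longrightarrow> nonmin n z' = nonmin n z \<Longrightarrow> z' = z"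
      using PE_first_edge[OF n xy] by metis
    have "nonmin n z - nonmin n x = {?m}" using z(3,4) by auto
    then have lab: "new_label x z = ?m" by (simp add: new_label_def)
    have "z' = z" if "PE_edge n x z'" "(PE_edge n)\<^sup>*\<^sup>* z' y" "new_label x z' = new_label x z" for z'
      using uniq[OF that(1,2)] edge_new_label[OF that(1)] z(3) lab that(3) by simp
    then show "\<exists>z. PE_edge n x z \<and> (PE_edge n)\<^sup>*\<^sup>* z y \<and> new_label x z = ?m \<and>
        (\<forall>z'. PE_edge n x z' \<and> (PE_edge n)\<^sup>*\<^sup>* z' y \<and> new_label x z' = new_label x z \<longrightarrow> z' = z)"
      using z lab by blast
  qed
  ultimately show ?thesis by (rule EL_shellableI)
qed

end
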